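(* Let $n\ge2$, $1\le k\le n-1$, $\alpha_1,\alpha_2\in\mathbb{R}$ with $\alpha_1\ge k-n$, and $p=\frac{\alpha_1+n}{k}\ge1+\alpha_2$, with strict inequality $p>1+\alpha_2$ when $\alpha_2>0$. For $\gamma\in\mathbb{R}$ consider $$\|\cos^\gamma d(0,\cdot)\,R_kf\|_{L^\infty(\Xi_k(\mathbb{S}^n))}\le C\|f\|_{L^{p,1}_{\alpha_1,\alpha_2}(\mathbb{S}^n)}\quad\text{for all even radial }f\in L^{p,1}_{\alpha_1,\alpha_2}(\mathbb{S}^n).\qquad( * )$$ (A) If $k\ge2$, $( * )$ holds if and only if $\gamma\ge\frac{1+\alpha_2}{p}$. (B) If $k=1$, $( * )$ holds if and only if $\gamma\ge\frac{1+\alpha_2}{p}$ and $p\ge2$.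
   Context: $\mathbb{S}^n\subset\mathbb{R}^{n+1}$ unit sphere with origin $0:=e_{n+1}$, distance $d$, surface measure $dx$. $\Xi_k(\mathbb{S}^n)$: $k$-dimensional totally geodesic submanifolds (intersections with $(k+1)$-dimensional linear subspaces) with $d(0,\xi)<\pi/2$, with rotation-invariant measure ($L^\infty$ = essential supremum). $R_kf(\xi)=\int_\xi f\,d_\xi x$. $L^{p,1}_{\alpha_1,\alpha_2}(\mathbb{S}^n)$ is the Lorentz space $L^{p,1}(\mathbb{S}^n,\mu)$ for $d\mu=\sin^{\alpha_1}d(0,x)|\cos d(0,x)|^{\alpha_2}dx$, with norm $p\int_0^\infty\mu(\{|f|>s\})^{1/p}ds$. Even radial: $f(x)=F(|x_{n+1}|)$. $C$ independent of $f$. *)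

theory Defs
  imports "HOL-Analysis.Analysis"
begin

text \<open>Surface measure on the unit sphere of a Euclidean space of dimension N:
  the push-forward of Lebesgue measure on the punctured unit ball under radial
  projection, multiplied by N (volume of the cone over A equals surface(A)/N).\<close>
definition sphere_measure :: "'a::euclidean_space measure" where
  "sphere_measure =
     density (distr (restrict_space lborel (ball 0 1 - {0}))
                    (restrict_space borel (sphere 0 1)) (\<lambda>y. y /\<^sub>R norm y))
             (\<lambda>_. of_nat DIM('a))"

definition sdist :: "'a::real_inner \<Rightarrow> 'a \<Rightarrow> real" where
  "sdist x y = arccos (x \<bullet> y)"

definition sdist_set :: "'a::real_inner \<Rightarrow> 'a set \<Rightarrow> real" where
  "sdist_set x S = Inf (sdist x ` S)"

definition enn_powr :: "ennreal \<Rightarrow> real \<Rightarrow> ennreal" where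
  "enn_powr x r = (if x = \<infinity> then \<infinity> else ennreal (enn2real x powr r))"

definition weighted_sphere_measure :: "'a::euclidean_space \<Rightarrow> real \<Rightarrow> real \<Rightarrow> 'a measure" where
  "weighted_sphere_measure ctr a1 a2 =
     density sphere_measure
       (\<lambda>x. ennreal (sin (sdist ctr x) powr a1 * \<bar>cos (sdist ctr x)\<bar> powr a2))"

definition lorentz_norm :: "'a measure \<Rightarrow> real \<Rightarrow> ('a \<Rightarrow> real) \<Rightarrow> ennreal" where
  "lorentz_norm M p f =
     ennreal p * (\<integral>\<^sup>+ s\<in>{0..}. enn_powr (emeasure M {x\<in>space M. \<bar>f x\<bar> > s}) (1/p) \<partial>lborel)"

definition even_radial :: "'a::real_inner \<Rightarrow> ('a \<Rightarrow> real) \<Rightarrow> bool" where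
  "even_radial ctr f \<longleftrightarrow> (\<exists>F. \<forall>x\<in>sphere 0 1. f x = F \<bar>x \<bullet> ctr\<bar>)"

definition param_iso :: "(real^'j::finite) set \<Rightarrow> (real^'k::finite \<Rightarrow> real^'j)" where
  "param_iso V = (SOME T. linear T \<and> (\<forall>y. norm (T y) = norm y) \<and> range T = V)"

text \<open>k-plane transform: integral of f over the great k-sphere xi = V \<inter> S^n,
  V a (k+1)-dimensional subspace, with the k-dimensional surface measure of xi.\<close>
definition radon_integrable :: "'k::finite itself \<Rightarrow> (real^'j \<Rightarrow> real) \<Rightarrow> (real^'j) set \<Rightarrow> bool" where
  "radon_integrable _ f V =
     integrable (sphere_measure :: (real^'k) measure) (\<lambda>y. f (param_iso V y))"

definition radon :: "'k::finite itself \<Rightarrow> (real^'j \<Rightarrow> real) \<Rightarrow> (real^'j) set \<Rightarrow> real" where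
  "radon _ f V = (\<integral>y. f (param_iso V y) \<partial>(sphere_measure :: (real^'k) measure))"

text \<open>Almost-everywhere with respect to the rotation invariant measure on Xi_k:
  a set of planes is null iff the set of matrices A (Lebesgue measure on
  (n+1) x (k+1) matrices) whose column space lies in it is null. We restrict to
  A of full rank k+1 whose column space xi satisfies d(ctr, xi) < pi/2.\<close>
definition AE_planes :: "'k::finite itself \<Rightarrow> real^'j \<Rightarrow> ((real^'j) set \<Rightarrow> bool) \<Rightarrow> bool" where
  "AE_planes _ ctr P \<longleftrightarrow>
     (AE A in (lborel :: (real^'k^'j) measure).
        (inj (\<lambda>y. A *v y) \<and> sdist_set ctr (range (\<lambda>y. A *v y) \<inter> sphere 0 1) < pi / 2)
        \<longrightarrow> P (range (\<lambda>y. A *v y)))"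

text \<open>The estimate (*):
  || cos^gamma d(ctr,.) R_k f ||_{L^infty(Xi_k)} <= C ||f||_{L^{p,1}_{a1,a2}}
  for all even radial f in L^{p,1}_{a1,a2}; the L^infty bound is written out as an
  almost-everywhere bound (which is what ess sup <= c means), together with
  a.e. definedness of R_k f.\<close>
definition radon_estimate :: "'k::finite itself \<Rightarrow> real^'j \<Rightarrow> real \<Rightarrow> real \<Rightarrow> real \<Rightarrow> real \<Rightarrow> bool" where
  "radon_estimate K ctr a1 a2 p \<gamma> \<longleftrightarrow>
     (\<exists>C::real. C \<ge> 0 \<and>
        (\<forall>f. f \<in> borel_measurable (sphere_measure :: (real^'j) measure) \<longrightarrow>
             even_radial ctr f \<longrightarrow>
             lorentz_norm (weighted_sphere_measure ctr a1 a2) p f < \<infinity> \<longrightarrow>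
             AE_planes K ctr (\<lambda>V. radon_integrable K f V \<and>
                ennreal \<bar>cos (sdist_set ctr (V \<inter> sphere 0 1)) powr \<gamma> * radon K f V\<bar>
                  \<le> ennreal C * lorentz_norm (weighted_sphere_measure ctr a1 a2) p f)))"

end

theory Submission
  imports Defs
begin

text \<open>In the coordinate t = |x . e|, with c the cosine of the distance from e to the plane and k the
  dimension of the great subsphere, the transform of f(x) = F(|x . e|) is a constant times the integral
  of F(c t) (1 - t^2) powr (k/2 - 1) over 0 < t < 1, and the weighted measure on the sphere becomes
  a constant times t powr a2 * (1 - t^2) powr (p k/2 - 1) dt.  The layer-cake formula
  reduces the estimate to indicator functions.  If p k \<ge> 2, dilation by c costs exactly
  the factor c powr (- (1 + a2)) and leaves a restricted-type inequality at c = 1.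
  Conversely, thin bands around the equator force the lower bound on \<gamma>, and thin bands that touch the
  great circles from inside force p \<ge> 2 when k = 1.\<close>

text \<open>With \<kappa> = k/2, the choice of p says a1 + n = 2 p \<kappa>, so the two densities
  are (1 - t^2) powr (\<kappa> - 1) and t powr a2 * (1 - t^2) powr (p \<kappa> - 1). Their quotient
  contains ((1 - t^2) powr \<kappa>) powr (p - 1), a power of the very quantity that measures how
  much mass the first density has beyond t. This balance of exponents is why the inequality on
  indicators closes with no room in p. The second Lorentz index 1 makes the norm an integral, over
  the levels, of the p-th root of the mass of the level set; this is what makes indicators
  sufficient. Dilation compares (1 - t^2) powr b at t and at c t, where b = p k/2 - 1, and this is
  favourable when b \<ge> 0. The lower bound on a1 says p \<ge> 1, so b \<ge> 0 is automatic for k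
  \<ge> 2, whereas for k = 1 it is the extra condition p \<ge> 2. For the converse the obstacle is
  the essential supremum: one bad plane refutes nothing. Each test band is therefore played against
  an open set of planes, and of the cosine c only an open interval containing it is known.\<close>

section \<open>Slice integration on the sphere\<close>

text \<open>For translation-invariant measures L and M, with B symmetric, evaluating the double integral of
  1(x in A) 1(y - x in B) in both orders gives L(A) M(B) = L(B) M(A); take B to be the unit ball.\<close>
lemma distr_lborel_orthogonal_transformation:
  fixes T :: "'a::euclidean_space \<Rightarrow> 'a"
  assumes T: "orthogonal_transformation T"
  shows "distr lborel borel T = lborel"
proof -
  have lin: "linear T" and norm_T: "norm (T x) = norm x" for x
    using T by (auto simp: orthogonal_transformation)
  have surj: "surj T"
    using T by (rule orthogonal_transformation_surj)
  have T_meas [measurable]: "T \<in> borel_measurable borel"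
    using lin by (intro borel_measurable_continuous_onI linear_continuous_on) (simp add: linear_conv_bounded_linear)
  define M where "M = distr lborel borel T"
  have [measurable_cong]: "sets M = sets borel" by (simp add: M_def)
  have M_shift: "(\<integral>\<^sup>+y. g (x + y) \<partial>M) = (\<integral>\<^sup>+y. g y \<partial>M)"
    if [measurable]: "g \<in> borel_measurable borel" for g :: "'a \<Rightarrow> ennreal" and x
  proof -
    obtain x' where x: "x = T x'" using surj by blast
    have "(\<integral>\<^sup>+y. g (x + y) \<partial>M) = (\<integral>\<^sup>+y. g (T (x' + y)) \<partial>lborel)"
      by (simp add: M_def nn_integral_distr x linear_add[OF lin])
    also have "\<dots> = (\<integral>\<^sup>+y. g (T y) \<partial>lborel)"
      by (subst (2) lborel_distr_plus[of x', symmetric]) (simp add: nn_integral_distr)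
    finally show ?thesis by (simp add: M_def nn_integral_distr)
  qed
  have L_shift: "(\<integral>\<^sup>+y. g (x + y) \<partial>lborel) = (\<integral>\<^sup>+y. g y \<partial>lborel)"
    if [measurable]: "g \<in> borel_measurable borel" for g :: "'a \<Rightarrow> ennreal" and x
    by (subst (2) lborel_distr_plus[of x, symmetric]) (simp add: nn_integral_distr)
  have sf: "sigma_finite_measure M"
  proof
    show "\<exists>A. countable A \<and> A \<subseteq> sets M \<and> \<Union> A = space M \<and> (\<forall>a\<in>A. emeasure M a \<noteq> \<infinity>)"
    proof (intro exI[of _ "range (\<lambda>n::nat. ball (0::'a) n)"] conjI ballI)
      show "\<Union> (range (\<lambda>n::nat. ball (0::'a) n)) = space M"
        by (auto simp: M_def reals_Archimedean2)
    next
      fix a assume "a \<in> range (\<lambda>n::nat. ball (0::'a) n)"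
      then obtain n :: nat where a: "a = ball 0 (real n)" by auto
      have "T -` a = a" by (auto simp: a norm_T)
      then have "emeasure M a = emeasure lborel (ball (0::'a) (real n))"
        by (simp add: M_def emeasure_distr a)
      then show "emeasure M a \<noteq> \<infinity>" by (simp add: emeasure_ball)
    qed auto
  qed
  interpret M: sigma_finite_measure M by (rule sf)
  interpret P: pair_sigma_finite "lborel :: 'a measure" M ..
  let ?B = "ball (0::'a) 1"
  have [measurable]: "?B \<in> sets borel" by simp
  \<comment> \<open>The ball is also invariant under \<open>T\<close>, so the two measures agree on
    it; this fixes the factor of proportionality as 1.\<close>
  have B_eq: "emeasure M ?B = emeasure lborel ?B"
  proof -
    have "T -` ?B = ?B" by (auto simp: norm_T)
    then show ?thesis by (simp add: M_def emeasure_distr)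
  qed
  have "M = lborel"
  proof (rule measure_eqI)
    show "sets M = sets lborel" by (simp add: M_def)
    fix A assume "A \<in> sets M"
    then have A [measurable]: "A \<in> sets borel" by (simp add: M_def)
    have "emeasure lborel A * emeasure M ?B
        = (\<integral>\<^sup>+x. indicator A x * (\<integral>\<^sup>+y. indicator ?B (-x + y) \<partial>M) \<partial>lborel)"
      by (subst M_shift) (simp_all add: nn_integral_multc)
    also have "\<dots> = (\<integral>\<^sup>+x. (\<integral>\<^sup>+y. indicator A x * indicator ?B (-x + y) \<partial>M) \<partial>lborel)"
      by (intro nn_integral_cong) (simp add: nn_integral_cmult)
    also have "\<dots> = (\<integral>\<^sup>+y. (\<integral>\<^sup>+x. indicator A x * indicator ?B (-x + y) \<partial>lborel) \<partial>M)"
      by (rule P.Fubini'[symmetric]) measurable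
    also have "\<dots> = (\<integral>\<^sup>+y. (\<integral>\<^sup>+x. indicator A (y + x) * indicator ?B x \<partial>lborel) \<partial>M)"
    proof (rule nn_integral_cong)
      fix y
      have "(\<integral>\<^sup>+x. indicator A x * indicator ?B (-x + y) \<partial>lborel)
          = (\<integral>\<^sup>+x. indicator A (y + x) * indicator ?B (-(y + x) + y) \<partial>lborel)"
        by (subst L_shift[of "\<lambda>x. indicator A x * indicator ?B (-x + y)" y]) auto
      also have "\<dots> = (\<integral>\<^sup>+x. indicator A (y + x) * indicator ?B x \<partial>lborel)"
        by (intro nn_integral_cong) (auto simp: indicator_def)
      finally show "(\<integral>\<^sup>+x. indicator A x * indicator ?B (-x + y) \<partial>lborel)
          = (\<integral>\<^sup>+x. indicator A (y + x) * indicator ?B x \<partial>lborel)" .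
    qed
    also have "\<dots> = (\<integral>\<^sup>+x. (\<integral>\<^sup>+y. indicator A (y + x) * indicator ?B x \<partial>M) \<partial>lborel)"
      by (rule P.Fubini') measurable
    also have "\<dots> = (\<integral>\<^sup>+x. (\<integral>\<^sup>+y. indicator A (x + y) \<partial>M) * indicator ?B x \<partial>lborel)"
      by (intro nn_integral_cong) (simp add: nn_integral_multc add.commute)
    also have "\<dots> = emeasure M A * emeasure lborel ?B"
      by (subst M_shift) (simp_all add: nn_integral_cmult)
    finally have eq: "emeasure lborel A * emeasure lborel ?B = emeasure M A * emeasure lborel ?B"
      by (simp add: B_eq)
    have "emeasure lborel ?B \<noteq> 0" "emeasure lborel ?B \<noteq> top"
      using unit_ball_vol_pos[of "real DIM('a)"] by (auto simp: emeasure_ball simp del: unit_ball_vol_pos)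
    with eq show "emeasure M A = emeasure lborel A"
      by (metis ennreal_mult_cancel_left mult.commute)
  qed
  then show ?thesis by (simp add: M_def)
qed

section \<open>Surface measure, and integrals over the ball in coordinates\<close>

lemma space_sphere_measure [simp]: "space sphere_measure = sphere 0 1"
  by (simp add: sphere_measure_def space_restrict_space)

lemma sets_sphere_measure [simp, measurable_cong]:
  "sets sphere_measure = sets (restrict_space borel (sphere 0 1))"
  by (simp add: sphere_measure_def)

lemma nn_integral_sphere_measure:
  fixes g :: "'a::euclidean_space \<Rightarrow> ennreal"
  assumes g: "g \<in> borel_measurable (restrict_space borel (sphere 0 1))"
  shows "(\<integral>\<^sup>+y. g y \<partial>sphere_measure) =
    of_nat DIM('a) * (\<integral>\<^sup>+y. g (y /\<^sub>R norm y) * indicator (ball 0 1 - {0}) y \<partial>lborel)"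
proof -
  have "(\<lambda>y::'a. y /\<^sub>R norm y) \<in> borel_measurable (restrict_space borel (ball 0 1 - {0}))"
    by (intro measurable_restrict_space1) measurable
  then have p: "(\<lambda>y::'a. y /\<^sub>R norm y) \<in> measurable (restrict_space borel (ball 0 1 - {0})) (restrict_space borel (sphere 0 1))"
    by (intro measurable_restrict_space2) (auto simp: space_restrict_space)
  then have p': "(\<lambda>y::'a. y /\<^sub>R norm y) \<in> measurable (restrict_space lborel (ball 0 1 - {0})) (restrict_space borel (sphere 0 1))"
    by (simp cong: measurable_cong_sets add: sets_restrict_space)
  show ?thesis
    unfolding sphere_measure_def using g p'
    by (simp add: nn_integral_density nn_integral_cmult nn_integral_distr
      nn_integral_restrict_space)
qed

abbreviation coord_norm :: "'i set \<Rightarrow> ('i \<Rightarrow> real) \<Rightarrow> real" where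
  "coord_norm A x \<equiv> sqrt (\<Sum>i\<in>A. (x i)\<^sup>2)"

text \<open>The zero set lies in every ball around the origin, and these have arbitrarily small
  volume because \<open>A\<close> is nonempty. It is needed because the substitution y = |z| \<tau>
  divides by |z|.\<close>

lemma AE_coord_norm_pos:
  assumes A: "finite A" "A \<noteq> {}"
  shows "AE x in Pi\<^sub>M A (\<lambda>_. lborel). 0 < coord_norm A x"
proof (rule AE_I)
  let ?M = "Pi\<^sub>M A (\<lambda>_. lborel) :: ('a \<Rightarrow> real) measure"
  let ?Z = "{x. coord_norm A x \<le> 0} \<inter> space ?M"
  show "{x \<in> space ?M. \<not> 0 < coord_norm A x} \<subseteq> ?Z" by auto
  show Z: "?Z \<in> sets ?M" by measurable
  have m: "card A \<ge> 1" using A by (simp add: Suc_le_eq card_gt_0_iff)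
  define V where "V = unit_ball_vol (real (card A))"
  have V: "V > 0" by (simp add: V_def)
  have "emeasure ?M ?Z \<le> ennreal e" if e: "0 < e" for e
  proof -
    \<comment> \<open>The bound r \<le> 1 gives r ^ card A \<le> r, and r \<le> e / V then makes the
      ball small enough.\<close>
    define r where "r = min 1 (e / V)"
    have r: "0 < r" "r \<le> 1" "V * r \<le> e" using e V by (auto simp: r_def min_def field_simps)
    have "emeasure ?M ?Z \<le> emeasure ?M ({x. coord_norm A x \<le> r} \<inter> space ?M)"
    proof (rule emeasure_mono)
      show "?Z \<subseteq> {x. coord_norm A x \<le> r} \<inter> space ?M"
        using r by (intro Int_mono Collect_mono impI order_refl) (erule order_trans, simp)
      show "{x. coord_norm A x \<le> r} \<inter> space ?M \<in> sets ?M" by measurable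
    qed
    also have "\<dots> = ennreal (V * r ^ card A)"
      unfolding V_def using A r by (intro emeasure_cball_aux) auto
    also have "\<dots> \<le> ennreal e"
    proof (intro ennreal_leI)
      have "r ^ card A \<le> r ^ 1" using r m by (intro power_decreasing) auto
      then show "V * r ^ card A \<le> e" using V r by (smt (verit) mult_left_mono power_one_right)
    qed
    finally show ?thesis .
  qed
  then show "emeasure ?M ?Z = 0"
    by (metis add_0 ennreal_le_epsilon le_zero_eq zero_le)
qed

text \<open>Write |x| as the integral of 1 over 0 < s < |x| and exchange: what remains for each s is
  the volume V (R^m - s^m) of the shell s < |x| \<le> R. With R = 1 / sqrt (1 + \<tau>^2) this is
  the integral over z left by the substitution y = |z| \<tau>.\<close>

lemma nn_integral_coord_norm_le:
  fixes A :: "'i set"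
  assumes A: "finite A" and R: "0 < R"
  shows "(\<integral>\<^sup>+x. ennreal (coord_norm A x) * indicator {..R} (coord_norm A x) \<partial>Pi\<^sub>M A (\<lambda>_. lborel))
    = ennreal (unit_ball_vol (card A) * card A / (card A + 1) * R ^ (card A + 1))"
proof -
  let ?M = "Pi\<^sub>M A (\<lambda>_. lborel) :: ('i \<Rightarrow> real) measure"
  define m where "m = card A"
  define V where "V = unit_ball_vol (real m)"
  have V: "V > 0" by (simp add: V_def)
  interpret product_sigma_finite "\<lambda>_::'i. lborel :: real measure" by standard
  have "pair_sigma_finite ?M (lborel :: real measure)"
    using A sigma_finite by (simp add: pair_sigma_finite_def lborel.sigma_finite_measure_axioms)
  then interpret P: pair_sigma_finite ?M "lborel :: real measure" .
  have "(\<integral>\<^sup>+x. ennreal (coord_norm A x) * indicator {..R} (coord_norm A x) \<partial>?M)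
    = (\<integral>\<^sup>+x. (\<integral>\<^sup>+s. indicator {0<..<coord_norm A x} s * indicator {..R} (coord_norm A x) \<partial>lborel) \<partial>?M)"
    by (intro nn_integral_cong) (simp add: nn_integral_multc sum_nonneg)
  also have "\<dots> = (\<integral>\<^sup>+x. (\<integral>\<^sup>+s. indicator {y. 0 < fst y \<and> fst y < snd y \<and> snd y \<le> R} (s, coord_norm A x) \<partial>lborel) \<partial>?M)"
    by (intro nn_integral_cong) (auto simp: indicator_def)
  also have "\<dots> = (\<integral>\<^sup>+s. (\<integral>\<^sup>+x. indicator {y. 0 < fst y \<and> fst y < snd y \<and> snd y \<le> R} (s, coord_norm A x) \<partial>?M) \<partial>lborel)"
    by (rule P.Fubini'[symmetric]) measurable
  also have "\<dots> = (\<integral>\<^sup>+s. ennreal (V * (R ^ m - s ^ m)) * indicator {0..R} s \<partial>lborel)"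
  proof (rule nn_integral_cong_AE)
    \<comment> \<open>At s = 0 the two sides differ: the left indicator demands s > 0, the right one
      is taken on the closed interval so that the fundamental theorem of calculus applies.\<close>
    have "AE s in lborel. s \<noteq> (0::real)" by (rule AE_lborel_singleton)
    then show "AE s in lborel. (\<integral>\<^sup>+x. indicator {y. 0 < fst y \<and> fst y < snd y \<and> snd y \<le> R} (s, coord_norm A x) \<partial>?M)
       = ennreal (V * (R ^ m - s ^ m)) * indicator {0..R} s"
    proof eventually_elim
      case (elim s)
      show ?case
      proof (cases "0 < s \<and> s \<le> R")
        case True
        let ?B = "\<lambda>r. {x. coord_norm A x \<le> r} \<inter> space ?M"
        have B: "?B r \<in> sets ?M" for r by measurable
        have "(\<integral>\<^sup>+x. indicator {y. 0 < fst y \<and> fst y < snd y \<and> snd y \<le> R} (s, coord_norm A x) \<partial>?M)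
          = (\<integral>\<^sup>+x. indicator (?B R - ?B s) x \<partial>?M)"
          using True by (intro nn_integral_cong) (auto simp: indicator_def)
        also have "\<dots> = emeasure ?M (?B R - ?B s)"
          using B by (intro nn_integral_indicator) auto
        also have "\<dots> = emeasure ?M (?B R) - emeasure ?M (?B s)"
          using B True emeasure_cball_aux[OF A, of s] by (intro emeasure_Diff) auto
        also have "\<dots> = ennreal (V * (R ^ m - s ^ m))"
          using True R V emeasure_cball_aux[OF A, of s] emeasure_cball_aux[OF A R]
          by (simp add: V_def m_def ennreal_minus right_diff_distrib)
        finally show ?thesis using True by simp
      next
        case False
        then have "(\<integral>\<^sup>+x. indicator {y. 0 < fst y \<and> fst y < snd y \<and> snd y \<le> R} (s, coord_norm A x) \<partial>?M) = (\<integral>\<^sup>+x. 0 \<partial>?M)"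
          by (intro nn_integral_cong) (auto simp: indicator_def)
        then show ?thesis using False elim by auto
      qed
    qed
  qed
  also have "\<dots> = ennreal (V * (R ^ m * R - R ^ (m + 1) / (m + 1)) - V * (R ^ m * 0 - 0 ^ (m + 1) / (m + 1)))"
    using R V
    by (intro nn_integral_FTC_Icc)
       (auto intro!: derivative_eq_intros mult_nonneg_nonneg power_mono simp del: power_Suc)
  also have "V * (R ^ m * R - R ^ (m + 1) / (m + 1)) - V * (R ^ m * 0 - 0 ^ (m + 1) / (m + 1))
      = V * m / (m + 1) * R ^ (m + 1)"
    by (simp add: field_simps)
  finally show ?thesis by (simp add: V_def m_def)
qed

text \<open>Writing a point as (z, y) with y its coordinate along e, the substitution y = |z| \<tau> makes the
  direction depend on \<tau> alone, and the integral over z only contributes a power of 1 + \<tau>^2.\<close>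
lemma nn_integral_ball_direction:
  fixes e :: "'a::euclidean_space" and G :: "real \<Rightarrow> ennreal"
  assumes e: "e \<in> Basis" and N: "DIM('a) \<ge> 2"
    and G [measurable]: "G \<in> borel_measurable borel"
  defines "m \<equiv> DIM('a) - 1"
  shows "(\<integral>\<^sup>+y. G (\<bar>(y /\<^sub>R norm y) \<bullet> e\<bar>) * indicator (ball 0 1 - {0}) (y::'a) \<partial>lborel) =
    ennreal (unit_ball_vol m * m / (m + 1)) *
      (\<integral>\<^sup>+\<tau>. G (\<bar>\<tau>\<bar> / sqrt (1 + \<tau>\<^sup>2)) * ennreal ((1 + \<tau>\<^sup>2) powr - (real DIM('a) / 2)) \<partial>lborel)"
proof -
  define A where "A = Basis - {e}"
  have A: "finite A" "e \<notin> A" "insert e A = Basis" "card A = m"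
    using e by (auto simp: A_def m_def card_Diff_singleton)
  have A_ne: "A \<noteq> {}" using A(4) N by (auto simp: m_def)
  let ?M = "Pi\<^sub>M A (\<lambda>_. lborel) :: ('a \<Rightarrow> real) measure"
  define H where "H \<rho> y = G (\<bar>y\<bar> / sqrt (\<rho>\<^sup>2 + y\<^sup>2)) * indicator {0<..1} (sqrt (\<rho>\<^sup>2 + y\<^sup>2))" for \<rho> y :: real
  have [measurable]: "case_prod H \<in> borel_measurable (borel \<Otimes>\<^sub>M borel)"
    unfolding H_def indicator_def by measurable
  interpret product_sigma_finite "\<lambda>_::'a. lborel :: real measure" by standard
  have "pair_sigma_finite ?M (lborel :: real measure)"
    using A sigma_finite by (simp add: pair_sigma_finite_def lborel.sigma_finite_measure_axioms)
  then interpret P: pair_sigma_finite ?M "lborel :: real measure" .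
  \<comment> \<open>The bounding sphere is null, so the open ball may be closed; the condition on z
    then becomes a closed ball, whose volume is known.\<close>
  have "emeasure lborel (cball (0::'a) 1 - ball 0 1) = 0"
    by (subst emeasure_Diff) (auto simp: emeasure_ball emeasure_cball)
  then have "AE y in lborel. y \<notin> cball (0::'a) 1 - ball 0 1"
    by (intro AE_not_in) (auto simp: null_sets_def)
  then have "(\<integral>\<^sup>+y. G (\<bar>(y /\<^sub>R norm y) \<bullet> e\<bar>) * indicator (ball 0 1 - {0}) (y::'a) \<partial>lborel)
     = (\<integral>\<^sup>+y. G (\<bar>y \<bullet> e\<bar> / norm y) * indicator {0<..1} (norm (y::'a)) \<partial>lborel)"
    by (intro nn_integral_cong_AE) (auto elim!: eventually_mono simp: indicator_def divide_simps abs_mult)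
  also have "\<dots> = (\<integral>\<^sup>+x. H (coord_norm A x) (x e) \<partial>Pi\<^sub>M (insert e A) (\<lambda>_. lborel))"
  proof -
    have "norm (\<Sum>b\<in>Basis. x b *\<^sub>R b :: 'a) = sqrt ((coord_norm A x)\<^sup>2 + (x e)\<^sup>2)" for x
    proof -
      have "norm (\<Sum>b\<in>Basis. x b *\<^sub>R b :: 'a) = sqrt (\<Sum>b\<in>Basis. (x b)\<^sup>2)"
        by (subst norm_eq_sqrt_inner, subst euclidean_inner) (simp add: power2_eq_square)
      also have "(\<Sum>b\<in>Basis. (x b)\<^sup>2) = (x e)\<^sup>2 + (\<Sum>b\<in>A. (x b)\<^sup>2)"
        using A(1,2) by (simp flip: A(3))
      finally show ?thesis by (simp add: sum_nonneg add.commute)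
    qed
    then show ?thesis
      unfolding A(3) H_def using e by (subst lborel_eq) (simp add: nn_integral_distr inner_sum_left inner_Basis if_distrib cong: if_cong)
  qed
  also have "\<dots> = (\<integral>\<^sup>+x. (\<integral>\<^sup>+y. H (coord_norm A x) y \<partial>lborel) \<partial>?M)"
  proof (subst product_nn_integral_insert)
    have eq: "(\<Sum>i\<in>A. ((x(e := y)) i)\<^sup>2) = (\<Sum>i\<in>A. (x i)\<^sup>2)" for x y
      using A by (intro sum.cong) auto
    show "(\<integral>\<^sup>+x. (\<integral>\<^sup>+y. H (coord_norm A (x(e := y))) ((x(e := y)) e) \<partial>lborel) \<partial>?M)
      = (\<integral>\<^sup>+x. (\<integral>\<^sup>+y. H (coord_norm A x) y \<partial>lborel) \<partial>?M)"
      by (simp only: eq fun_upd_same)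
  next
    show "(\<lambda>x. H (coord_norm A x) (x e)) \<in> borel_measurable (Pi\<^sub>M (insert e A) (\<lambda>_. lborel))"
      by measurable
  qed (use A in auto)
  also have "\<dots> = (\<integral>\<^sup>+x. (\<integral>\<^sup>+\<tau>. G (\<bar>\<tau>\<bar> / sqrt (1 + \<tau>\<^sup>2)) *
       (ennreal (coord_norm A x) * indicator {..1 / sqrt (1 + \<tau>\<^sup>2)} (coord_norm A x)) \<partial>lborel) \<partial>?M)"
  proof (rule nn_integral_cong_AE)
    show "AE x in ?M. (\<integral>\<^sup>+y. H (coord_norm A x) y \<partial>lborel) = (\<integral>\<^sup>+\<tau>. G (\<bar>\<tau>\<bar> / sqrt (1 + \<tau>\<^sup>2)) *
       (ennreal (coord_norm A x) * indicator {..1 / sqrt (1 + \<tau>\<^sup>2)} (coord_norm A x)) \<partial>lborel)"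
      using AE_coord_norm_pos[OF A(1) A_ne]
    proof eventually_elim
      case (elim x)
      define \<rho> where "\<rho> = coord_norm A x"
      have \<rho>: "\<rho> > 0" using elim by (simp add: \<rho>_def)
      \<comment> \<open>The direction is homogeneous of degree 0 and loses \<rho>, while the radius
        condition turns into an upper bound on \<rho>. The summand 0 gives the affine form of the
        substitution rule.\<close>
      have "H \<rho> (0 + \<rho> * \<tau>) = G (\<bar>\<tau>\<bar> / sqrt (1 + \<tau>\<^sup>2)) * indicator {..1 / sqrt (1 + \<tau>\<^sup>2)} \<rho>" for \<tau>
      proof -
        have "sqrt (\<rho>\<^sup>2 + (\<rho> * \<tau>)\<^sup>2) = \<rho> * sqrt (1 + \<tau>\<^sup>2)"
          using \<rho> by (intro real_sqrt_unique) (auto simp: power_mult_distrib algebra_simps)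
        moreover have "sqrt (1 + \<tau>\<^sup>2) > 0" by (simp add: add_pos_nonneg)
        ultimately show ?thesis
          using \<rho> by (auto simp: H_def abs_mult indicator_def field_simps)
      qed
      moreover have "(\<integral>\<^sup>+y. H \<rho> y \<partial>lborel) = \<bar>\<rho>\<bar> * (\<integral>\<^sup>+\<tau>. H \<rho> (0 + \<rho> * \<tau>) \<partial>lborel)"
        using \<rho> by (intro nn_integral_real_affine) auto
      moreover have "(\<lambda>\<tau>. G (\<bar>\<tau>\<bar> / sqrt (1 + \<tau>\<^sup>2)) * indicator {..1 / sqrt (1 + \<tau>\<^sup>2)} \<rho>) \<in> borel_measurable lborel"
        unfolding indicator_def atMost_iff by measurable
      ultimately have "(\<integral>\<^sup>+y. H \<rho> y \<partial>lborel) = (\<integral>\<^sup>+\<tau>. \<rho> * (G (\<bar>\<tau>\<bar> / sqrt (1 + \<tau>\<^sup>2)) * indicator {..1 / sqrt (1 + \<tau>\<^sup>2)} \<rho>) \<partial>lborel)"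
        using \<rho> by (simp add: nn_integral_cmult)
      then show ?case unfolding \<rho>_def[symmetric] by (simp add: mult_ac)
    qed
  qed
  also have "\<dots> = (\<integral>\<^sup>+\<tau>. (\<integral>\<^sup>+x. G (\<bar>\<tau>\<bar> / sqrt (1 + \<tau>\<^sup>2)) *
       (ennreal (coord_norm A x) * indicator {..1 / sqrt (1 + \<tau>\<^sup>2)} (coord_norm A x)) \<partial>?M) \<partial>lborel)"
    unfolding indicator_def atMost_iff by (rule P.Fubini'[symmetric]) measurable
  also have "\<dots> = (\<integral>\<^sup>+\<tau>. ennreal (unit_ball_vol m * m / (m + 1)) *
       (G (\<bar>\<tau>\<bar> / sqrt (1 + \<tau>\<^sup>2)) * ennreal ((1 + \<tau>\<^sup>2) powr - (real DIM('a) / 2))) \<partial>lborel)"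
  proof (rule nn_integral_cong)
    fix \<tau> :: real
    have pos: "1 + \<tau>\<^sup>2 > 0" by (simp add: add_pos_nonneg)
    have "(1 / sqrt (1 + \<tau>\<^sup>2)) ^ (m + 1) = (1 + \<tau>\<^sup>2) powr - (real DIM('a) / 2)"
    proof -
      have "1 / sqrt (1 + \<tau>\<^sup>2) = (1 + \<tau>\<^sup>2) powr - (1/2)"
        using pos by (simp add: powr_minus powr_half_sqrt field_simps)
      moreover have "m + 1 = DIM('a)" using N by (simp add: m_def)
      ultimately show ?thesis using pos
        by (simp add: powr_realpow[symmetric] powr_powr)
    qed
    moreover have "(\<integral>\<^sup>+x. ennreal (coord_norm A x) * indicator {..1 / sqrt (1 + \<tau>\<^sup>2)} (coord_norm A x) \<partial>?M)
       = ennreal (unit_ball_vol m * m / (m + 1) * (1 / sqrt (1 + \<tau>\<^sup>2)) ^ (m + 1))"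
      using pos A by (subst nn_integral_coord_norm_le) auto
    ultimately have "(\<integral>\<^sup>+x. ennreal (coord_norm A x) * indicator {..1 / sqrt (1 + \<tau>\<^sup>2)} (coord_norm A x) \<partial>?M)
       = ennreal (unit_ball_vol m * m / (m + 1)) * ennreal ((1 + \<tau>\<^sup>2) powr - (real DIM('a) / 2))"
      by (simp only:) (intro ennreal_mult, auto)
    then show "(\<integral>\<^sup>+x. G (\<bar>\<tau>\<bar> / sqrt (1 + \<tau>\<^sup>2)) *
       (ennreal (coord_norm A x) * indicator {..1 / sqrt (1 + \<tau>\<^sup>2)} (coord_norm A x)) \<partial>?M)
       = ennreal (unit_ball_vol m * m / (m + 1)) *
       (G (\<bar>\<tau>\<bar> / sqrt (1 + \<tau>\<^sup>2)) * ennreal ((1 + \<tau>\<^sup>2) powr - (real DIM('a) / 2)))"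
      by (subst nn_integral_cmult) (auto simp: mult_ac)
  qed
  also have "\<dots> = ennreal (unit_ball_vol m * m / (m + 1)) *
      (\<integral>\<^sup>+\<tau>. G (\<bar>\<tau>\<bar> / sqrt (1 + \<tau>\<^sup>2)) * ennreal ((1 + \<tau>\<^sup>2) powr - (real DIM('a) / 2)) \<partial>lborel)"
    by (rule nn_integral_cmult) measurable
  finally show ?thesis .
qed

text \<open>Continuity from below of the measure with density f. It passes from compact intervals to
  the full range of an improper substitution.\<close>

lemma nn_integral_incseq_SUP:
  fixes f :: "'a \<Rightarrow> ennreal"
  assumes [measurable]: "f \<in> borel_measurable M" and A: "range A \<subseteq> sets M" "incseq A"
  shows "(\<integral>\<^sup>+x. f x * indicator (\<Union>i. A i) x \<partial>M) = (SUP i. \<integral>\<^sup>+x. f x * indicator (A i) x \<partial>M)"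
proof -
  have [measurable]: "A i \<in> sets M" for i using A by auto
  have "emeasure (density M f) (\<Union>i. A i) = (SUP i. emeasure (density M f) (A i))"
    using A by (intro SUP_emeasure_incseq[symmetric]) auto
  then show ?thesis by (simp add: emeasure_density)
qed

lemma nn_integral_even:
  fixes h :: "real \<Rightarrow> ennreal"
  assumes [measurable]: "h \<in> borel_measurable borel"
  shows "(\<integral>\<^sup>+x. h \<bar>x\<bar> \<partial>lborel) = 2 * (\<integral>\<^sup>+x. h x * indicator {0..} x \<partial>lborel)"
proof -
  have "(\<integral>\<^sup>+x. h \<bar>x\<bar> \<partial>lborel) = (\<integral>\<^sup>+x. h \<bar>x\<bar> * indicator {0..} x + h \<bar>x\<bar> * indicator {..0} x \<partial>lborel)"
    by (intro nn_integral_cong_AE AE_I[of _ _ "{0}"]) (auto simp: indicator_def)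
  also have "\<dots> = (\<integral>\<^sup>+x. h \<bar>x\<bar> * indicator {0..} x \<partial>lborel) + (\<integral>\<^sup>+x. h \<bar>x\<bar> * indicator {..0} x \<partial>lborel)"
    by (intro nn_integral_add) auto
  also have "(\<integral>\<^sup>+x. h \<bar>x\<bar> * indicator {..0} x \<partial>lborel) = (\<integral>\<^sup>+x. h \<bar>x\<bar> * indicator {0..} x \<partial>lborel)"
    by (subst nn_integral_real_affine[of _ "-1" 0]) (auto simp: indicator_def intro!: nn_integral_cong)
  also have "(\<integral>\<^sup>+x. h \<bar>x\<bar> * indicator {0..} x \<partial>lborel) = (\<integral>\<^sup>+x. h x * indicator {0..} x \<partial>lborel)"
    by (intro nn_integral_cong) (auto simp: indicator_def)
  finally show ?thesis by (simp add: mult_2)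
qed

text \<open>The inverse substitution is \<tau> = t / sqrt (1 - t^2), for which 1 + \<tau>^2 = 1 / (1
  - t^2) and d\<tau> = (1 - t^2) powr (- 3/2) dt. The derivative blows up at t = 1, so the change of
  variables is made on compact intervals and followed by a supremum.\<close>

lemma nn_integral_gnomonic_substitution:
  fixes G :: "real \<Rightarrow> ennreal" and s :: real
  assumes [measurable]: "G \<in> borel_measurable borel"
  shows "(\<integral>\<^sup>+\<tau>. G (\<tau> / sqrt (1 + \<tau>\<^sup>2)) * ennreal ((1 + \<tau>\<^sup>2) powr - s) * indicator {0..} \<tau> \<partial>lborel)
    = (\<integral>\<^sup>+t. G t * ennreal ((1 - t\<^sup>2) powr (s - 3/2)) * indicator {0..<1} t \<partial>lborel)"
proof -
  define f where "f \<tau> = G (\<tau> / sqrt (1 + \<tau>\<^sup>2)) * ennreal ((1 + \<tau>\<^sup>2) powr - s)" for \<tau> :: real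
  have f [measurable]: "f \<in> borel_measurable borel" unfolding f_def by measurable
  define g where "g t = t / sqrt (1 - t\<^sup>2)" for t :: real
  define g' where "g' t = (1 - t\<^sup>2) powr (- 3/2)" for t :: real
  \<comment> \<open>Any sequence in (0,1) increasing to 1 would do; the summand 2 keeps the first
    term positive.\<close>
  define b where "b n = 1 - 1 / (real n + 2)" for n
  have b: "0 < b n" "b n < 1" for n by (auto simp: b_def field_simps)
  have b_mono: "b m \<le> b n" if "m \<le> n" for m n using that by (simp add: b_def frac_le)
  have sq: "t\<^sup>2 < 1" if "0 \<le> t" "t < 1" for t :: real
    using that by (simp add: power_less_one_iff)
  have g_mono: "g x \<le> g y" if "0 \<le> x" "x \<le> y" "y < 1" for x y
    unfolding g_def using that sq[of x] sq[of y]
    by (intro frac_le real_sqrt_le_mono) (auto intro: power_mono)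
  have step: "(\<integral>\<^sup>+\<tau>. f \<tau> * indicator {0..g (b n)} \<tau> \<partial>lborel)
      = (\<integral>\<^sup>+t. G t * ennreal ((1 - t\<^sup>2) powr (s - 3/2)) * indicator {0..b n} t \<partial>lborel)" for n
  proof -
    have "(\<integral>\<^sup>+\<tau>. f \<tau> * indicator {g 0..g (b n)} \<tau> \<partial>lborel)
       = (\<integral>\<^sup>+t. f (g t) * g' t * indicator {0..b n} t \<partial>lborel)"
    proof (rule nn_integral_substitution_aux)
      fix t assume t: "t \<in> {0..b n}"
      then have t1: "1 - t\<^sup>2 > 0" using sq[of t] b[of n] by auto
      show "(g has_real_derivative g' t) (at t)"
      proof -
        have "(g has_real_derivative (sqrt (1 - t\<^sup>2) + t\<^sup>2 / sqrt (1 - t\<^sup>2)) / (1 - t\<^sup>2)) (at t)"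
          unfolding g_def using t1
          by (auto intro!: derivative_eq_intros simp: field_simps power2_eq_square)
        moreover have "(sqrt (1 - t\<^sup>2) + t\<^sup>2 / sqrt (1 - t\<^sup>2)) / (1 - t\<^sup>2) = g' t"
        proof -
          have "sqrt (1 - t\<^sup>2) + t\<^sup>2 / sqrt (1 - t\<^sup>2) = 1 / sqrt (1 - t\<^sup>2)"
            using t1 by (simp add: field_simps)
          moreover have "g' t = 1 / (sqrt (1 - t\<^sup>2) * (1 - t\<^sup>2))"
          proof -
            have "(1 - t\<^sup>2) powr (3/2) = (1 - t\<^sup>2) powr (1/2) * (1 - t\<^sup>2) powr 1"
              unfolding powr_add[symmetric] by simp
            then show ?thesis using t1
              by (simp add: g'_def powr_minus powr_half_sqrt field_simps)
          qed
          ultimately show ?thesis by simp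
        qed
        ultimately show ?thesis by simp
      qed
      show "g' t \<ge> 0" by (simp add: g'_def)
    next
      show "continuous_on {0..b n} g'"
      proof -
        have "1 - t\<^sup>2 \<noteq> 0" if "t \<in> {0..b n}" for t
          using sq[of t] b(2)[of n] that by auto
        then show ?thesis unfolding g'_def by (intro continuous_intros) auto
      qed
    qed (use b in auto)
    also have "\<dots> = (\<integral>\<^sup>+t. G t * ennreal ((1 - t\<^sup>2) powr (s - 3/2)) * indicator {0..b n} t \<partial>lborel)"
    proof (intro nn_integral_cong)
      fix t :: real
      show "f (g t) * g' t * indicator {0..b n} t = G t * ennreal ((1 - t\<^sup>2) powr (s - 3/2)) * indicator {0..b n} t"
      proof (cases "t \<in> {0..b n}")
        case True
        then have t1: "1 - t\<^sup>2 > 0" using sq[of t] b[of n] by auto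
        have 1: "1 + (g t)\<^sup>2 = 1 / (1 - t\<^sup>2)" using t1 by (simp add: g_def field_simps power_divide)
        have "g t / sqrt (1 + (g t)\<^sup>2) = t"
          unfolding 1 using t1 by (simp add: g_def real_sqrt_divide)
        moreover have "(1 + (g t)\<^sup>2) powr - s = (1 - t\<^sup>2) powr s"
          unfolding 1 using t1 by (simp add: powr_divide powr_minus)
        moreover have "(1 - t\<^sup>2) powr s * g' t = (1 - t\<^sup>2) powr (s - 3/2)"
          unfolding g'_def powr_add[symmetric] by simp
        ultimately have "f (g t) * g' t = G t * ennreal ((1 - t\<^sup>2) powr (s - 3/2))"
          by (simp add: f_def mult.assoc ennreal_mult[symmetric] g'_def)
        then show ?thesis by simp
      qed simp
    qed
    finally show ?thesis by (simp add: g_def)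
  qed
  have U1: "(\<Union>n. {0..g (b n)}) = {0..}"
  proof (intro equalityI subsetI)
    fix \<tau> :: real assume "\<tau> \<in> {0..}"
    then have \<tau>: "\<tau> \<ge> 0" by simp
    define t where "t = \<tau> / sqrt (1 + \<tau>\<^sup>2)"
    have pos: "1 + \<tau>\<^sup>2 > 0" by (simp add: add_pos_nonneg)
    have "\<tau> < sqrt (1 + \<tau>\<^sup>2)" by (rule real_less_rsqrt) simp
    then have t: "0 \<le> t" "t < 1" using \<tau> pos by (auto simp: t_def)
    have "1 - t\<^sup>2 = 1 / (1 + \<tau>\<^sup>2)" using pos by (simp add: t_def power_divide field_simps)
    then have gt: "g t = \<tau>" using pos by (simp add: g_def real_sqrt_divide) (simp add: t_def)
    obtain n :: nat where "n > 1 / (1 - t)" using reals_Archimedean2 by blast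
    then have "t \<le> b n" using t by (auto simp: b_def field_simps)
    then have "\<tau> \<le> g (b n)" using g_mono[of t "b n"] t b gt by auto
    then show "\<tau> \<in> (\<Union>n. {0..g (b n)})" using \<tau> by auto
  qed auto
  have U2: "(\<Union>n. {0..b n}) = {0..<1}"
  proof (intro equalityI subsetI)
    fix t :: real assume t: "t \<in> {0..<1}"
    obtain n :: nat where "n > 1 / (1 - t)" using reals_Archimedean2 by blast
    then have "t \<le> b n" using t by (auto simp: b_def field_simps)
    then show "t \<in> (\<Union>n. {0..b n})" using t by auto
  qed (use b in \<open>auto intro: le_less_trans\<close>)
  have "(\<integral>\<^sup>+\<tau>. f \<tau> * indicator {0..} \<tau> \<partial>lborel) = (SUP n. \<integral>\<^sup>+\<tau>. f \<tau> * indicator {0..g (b n)} \<tau> \<partial>lborel)"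
    unfolding U1[symmetric]
  proof (rule nn_integral_incseq_SUP)
    show "incseq (\<lambda>n. {0..g (b n)})"
      using b b_mono by (intro monoI) (auto intro!: g_mono order_trans[OF _ g_mono] simp: less_imp_le)
  qed auto
  also have "\<dots> = (SUP n. \<integral>\<^sup>+t. G t * ennreal ((1 - t\<^sup>2) powr (s - 3/2)) * indicator {0..b n} t \<partial>lborel)"
    by (simp only: step)
  also have "\<dots> = (\<integral>\<^sup>+t. G t * ennreal ((1 - t\<^sup>2) powr (s - 3/2)) * indicator {0..<1} t \<partial>lborel)"
    unfolding U2[symmetric]
  proof (rule nn_integral_incseq_SUP[symmetric])
    show "incseq (\<lambda>n. {0..b n})"
      using b_mono by (intro monoI) (auto intro: order_trans)
  qed auto
  finally show ?thesis by (simp add: f_def)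
qed

text \<open>Twice the area of the unit sphere of one dimension less. The section of the sphere at
  height t is a copy of that sphere of radius sqrt (1 - t^2), and the heights t and -t are counted
  together.\<close>

definition slice_const :: "nat \<Rightarrow> real" where
  "slice_const N = 2 * unit_ball_vol (real N - 1) * (real N - 1)"

lemma slice_const_pos: "N \<ge> 2 \<Longrightarrow> slice_const N > 0"
  by (simp add: slice_const_def)

text \<open>Rotation invariance moves e to a coordinate vector. The formula for the cone over the
  sphere then applies, and the gnomonic substitution turns the slope \<tau> into the height
  t.\<close>

lemma nn_integral_sphere_slice:
  fixes e :: "real^'n" and G :: "real \<Rightarrow> ennreal"
  assumes e: "norm e = 1" and N: "CARD('n) \<ge> 2"
    and G [measurable]: "G \<in> borel_measurable borel"
  shows "(\<integral>\<^sup>+y. G \<bar>y \<bullet> e\<bar> \<partial>sphere_measure) = ennreal (slice_const CARD('n)) *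
      (\<integral>\<^sup>+t. G t * ennreal ((1 - t\<^sup>2) powr ((real CARD('n) - 3) / 2)) * indicator {0<..<1} t \<partial>lborel)"
proof -
  let ?N = "CARD('n)"
  obtain i :: 'n where True by blast
  define b where "b = (axis i 1 :: real^'n)"
  have b: "b \<in> Basis" by (simp add: b_def)
  obtain T where T: "orthogonal_transformation T" "T b = e"
    using orthogonal_transformation_exists[of b e] e b by auto
  have lin: "linear T" and normT: "norm (T x) = norm x" for x
    using T by (auto simp: orthogonal_transformation)
  have T0: "T x = 0 \<longleftrightarrow> x = 0" for x
    by (metis normT norm_eq_zero)
  have innerT: "T x \<bullet> e = x \<bullet> b" for x
    using T unfolding orthogonal_transformation_def by metis
  have [measurable]: "T \<in> borel_measurable borel"
    using lin by (intro borel_measurable_continuous_onI linear_continuous_on) (simp add: linear_conv_bounded_linear)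
  have [measurable]: "ball 0 1 - {0} \<in> sets (borel :: (real^'n) measure)" by simp
  define I where "I = (\<integral>\<^sup>+t. G t * ennreal ((1 - t\<^sup>2) powr ((real ?N - 3) / 2)) * indicator {0<..<1} t \<partial>lborel)"
  \<comment> \<open>The constant m/(m + 1) of the ball formula at m = N - 1; its denominator cancels
    against the factor N in the definition of surface measure.\<close>
  define K where "K = unit_ball_vol (real ?N - 1) * (real ?N - 1) / real ?N"
  have K: "K \<ge> 0" using N by (simp add: K_def)
  have "(\<integral>\<^sup>+y. G \<bar>y \<bullet> e\<bar> \<partial>sphere_measure) =
    of_nat ?N * (\<integral>\<^sup>+y. G \<bar>(y /\<^sub>R norm y) \<bullet> e\<bar> * indicator (ball 0 1 - {0}) y \<partial>lborel)"
    by (subst nn_integral_sphere_measure) (auto intro!: measurable_restrict_space1)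
  also have "(\<integral>\<^sup>+y. G \<bar>(y /\<^sub>R norm y) \<bullet> e\<bar> * indicator (ball 0 1 - {0}) y \<partial>lborel)
     = (\<integral>\<^sup>+y. G \<bar>(T y /\<^sub>R norm (T y)) \<bullet> e\<bar> * indicator (ball 0 1 - {0}) (T y) \<partial>lborel)"
    using nn_integral_distr[of T lborel borel "\<lambda>y. G \<bar>(y /\<^sub>R norm y) \<bullet> e\<bar> * indicator (ball 0 1 - {0}) y"]
    unfolding distr_lborel_orthogonal_transformation[OF T(1)] by measurable
  also have "\<dots> = (\<integral>\<^sup>+y. G \<bar>(y /\<^sub>R norm y) \<bullet> b\<bar> * indicator (ball 0 1 - {0}) y \<partial>lborel)"
    using T0 by (intro nn_integral_cong) (simp add: normT innerT indicator_def)
  also have "\<dots> = ennreal K *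
      (\<integral>\<^sup>+\<tau>. G (\<bar>\<tau>\<bar> / sqrt (1 + \<tau>\<^sup>2)) * ennreal ((1 + \<tau>\<^sup>2) powr - (real ?N / 2)) \<partial>lborel)"
    using N by (subst nn_integral_ball_direction[OF b]) (auto simp: K_def of_nat_diff)
  also have "(\<integral>\<^sup>+\<tau>. G (\<bar>\<tau>\<bar> / sqrt (1 + \<tau>\<^sup>2)) * ennreal ((1 + \<tau>\<^sup>2) powr - (real ?N / 2)) \<partial>lborel) = 2 * I"
  proof -
    have "(\<integral>\<^sup>+\<tau>. G (\<bar>\<tau>\<bar> / sqrt (1 + \<tau>\<^sup>2)) * ennreal ((1 + \<tau>\<^sup>2) powr - (real ?N / 2)) \<partial>lborel)
      = 2 * (\<integral>\<^sup>+\<tau>. G (\<tau> / sqrt (1 + \<tau>\<^sup>2)) * ennreal ((1 + \<tau>\<^sup>2) powr - (real ?N / 2)) * indicator {0..} \<tau> \<partial>lborel)"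
      using nn_integral_even[of "\<lambda>\<tau>. G (\<tau> / sqrt (1 + \<tau>\<^sup>2)) * ennreal ((1 + \<tau>\<^sup>2) powr - (real ?N / 2))"]
      by simp
    also have "\<dots> = 2 * (\<integral>\<^sup>+t. G t * ennreal ((1 - t\<^sup>2) powr (real ?N / 2 - 3/2)) * indicator {0..<1} t \<partial>lborel)"
      by (subst nn_integral_gnomonic_substitution) auto
    also have "(\<integral>\<^sup>+t. G t * ennreal ((1 - t\<^sup>2) powr (real ?N / 2 - 3/2)) * indicator {0..<1} t \<partial>lborel) = I"
      unfolding I_def
      by (intro nn_integral_cong_AE AE_I[of _ _ "{0}"]) (auto simp: indicator_def diff_divide_distrib)
    finally show ?thesis .
  qed
  also have "of_nat ?N * (ennreal K * (2 * I)) = ennreal (slice_const ?N) * I"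
  proof -
    have "ennreal (slice_const ?N) = ennreal (real ?N) * ennreal K * ennreal 2"
    proof -
      have "slice_const ?N = real ?N * K * 2" using N by (simp add: slice_const_def K_def)
      then show ?thesis using K by (simp only: ennreal_mult of_nat_0_le_iff mult_nonneg_nonneg zero_le_numeral)
    qed
    then show ?thesis by (simp add: mult_ac ennreal_of_nat_eq_real_of_nat)
  qed
  finally show ?thesis by (simp add: I_def)
qed

section \<open>The one-dimensional inequality\<close>

text \<open>Up to \<open>slice_const\<close>, the distribution of |x . e| on a sphere. It is a
  measure on the whole line concentrated on (0,1), so preimages under dilation need no change of
  space.\<close>

definition slice_measure :: "real \<Rightarrow> real \<Rightarrow> real measure" where
  "slice_measure a b =
     density lborel (\<lambda>t. ennreal (t powr a * (1 - t\<^sup>2) powr b) * indicator {0<..<1} t)"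

lemma sets_slice_measure [simp, measurable_cong]: "sets (slice_measure a b) = sets borel"
  by (simp add: slice_measure_def)

lemma space_slice_measure [simp]: "space (slice_measure a b) = UNIV"
  by (simp add: slice_measure_def)

lemma nn_integral_slice_measure:
  assumes [measurable]: "G \<in> borel_measurable borel"
  shows "(\<integral>\<^sup>+t. G t \<partial>slice_measure a b) =
    (\<integral>\<^sup>+t. ennreal (t powr a * (1 - t\<^sup>2) powr b) * G t * indicator {0<..<1} t \<partial>lborel)"
  unfolding slice_measure_def by (subst nn_integral_density) (auto simp: mult_ac)

lemma emeasure_slice_measure:
  assumes [measurable]: "E \<in> sets borel"
  shows "emeasure (slice_measure a b) E =
    (\<integral>\<^sup>+t. ennreal (t powr a * (1 - t\<^sup>2) powr b) * indicator E t * indicator {0<..<1} t \<partial>lborel)"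
  unfolding slice_measure_def by (subst emeasure_density) (auto simp: mult_ac)

section \<open>Mass near the endpoints 0 and 1\<close>

lemma one_minus_square_bounds:
  fixes t :: real assumes "0 < t" "t < 1" shows "0 < 1 - t\<^sup>2" "1 - t\<^sup>2 \<le> 1"
  using assms by (auto simp: power_less_one_iff)

text \<open>For use with x = 1 - t^2 and 0 < t \<le> 1/2: away from t = 1 the second factor of the
  density is bounded by an absolute constant, even when its exponent is negative.\<close>

lemma powr_le_four_thirds:
  fixes x b :: real
  assumes "3/4 \<le> x" "x \<le> 1" "-1 \<le> b"
  shows "x powr b \<le> 4/3"
proof -
  have "x powr b \<le> x powr (-1)" using assms by (intro powr_mono') auto
  also have "\<dots> \<le> 4/3" using assms by (simp add: powr_minus field_simps)
  finally show ?thesis .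
qed

text \<open>The factor 2 u makes the integrand the derivative of -(1 - u^2) powr \<kappa> /
  \<kappa>. For \<kappa> < 1 the integrand is unbounded at 1, but this antiderivative stays
  continuous there, which is all that the interior form of the fundamental theorem asks.\<close>

lemma nn_integral_end_segment:
  fixes a \<kappa> :: real
  assumes a: "0 \<le> a" "a \<le> 1" and \<kappa>: "\<kappa> > 0"
  shows "(\<integral>\<^sup>+u. ennreal (2 * u * (1 - u\<^sup>2) powr (\<kappa> - 1)) * indicator {a..1} u \<partial>lborel) = ennreal ((1 - a\<^sup>2) powr \<kappa> / \<kappa>)"
proof -
  have "((\<lambda>u. 2 * u * (1 - u\<^sup>2) powr (\<kappa> - 1)) has_integral
      (- ((1 - 1\<^sup>2) powr \<kappa> / \<kappa>) - (- ((1 - a\<^sup>2) powr \<kappa> / \<kappa>)))) {a..1}"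
  proof (rule fundamental_theorem_of_calculus_interior)
    show "a \<le> 1" by fact
    show "continuous_on {a..1} (\<lambda>u. - ((1 - u\<^sup>2) powr \<kappa> / \<kappa>))"
      using a \<kappa> by (intro continuous_intros continuous_on_powr') (auto simp: power_le_one)
    fix u assume u: "u \<in> {a<..<1}"
    then have pos: "1 - u\<^sup>2 > 0" using a one_minus_square_bounds[of u] by auto
    have "((\<lambda>u. - ((1 - u\<^sup>2) powr \<kappa> / \<kappa>)) has_real_derivative
        - (\<kappa> * (1 - u\<^sup>2) powr (\<kappa> - 1) * (- (2 * u)) / \<kappa>)) (at u)"
      using pos \<kappa> by (auto intro!: derivative_eq_intros simp: powr_diff field_simps)
    then show "((\<lambda>u. - ((1 - u\<^sup>2) powr \<kappa> / \<kappa>)) has_vector_derivative 2 * u * (1 - u\<^sup>2) powr (\<kappa> - 1)) (at u)"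
      using \<kappa> by (simp add: has_real_derivative_iff_has_vector_derivative mult_ac)
  qed
  then have "((\<lambda>u. 2 * u * (1 - u\<^sup>2) powr (\<kappa> - 1)) has_integral (1 - a\<^sup>2) powr \<kappa> / \<kappa>) {a..1}"
    by simp
  from nn_integral_has_integral_lebesgue[OF _ this] show ?thesis
    using a by (simp add: mult.commute ennreal_mult' ennreal_indicator mult_nonneg_nonneg)
qed

text \<open>The function u * (1 - u^2) powr \<kappa> is small only near the two endpoints. For u
  \<le> 1/2 smallness means u = O(\<epsilon>), where the density is bounded. For u > 1/2 it means (1
  - u^2) powr \<kappa> < 2 \<epsilon>; there the density is at most 2 u times itself, whose exact
  integral is again O(\<epsilon>).\<close>

lemma emeasure_slice_sublevel:
  fixes \<kappa> \<epsilon> :: real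
  assumes \<kappa>: "\<kappa> > 0" and \<epsilon>: "\<epsilon> > 0"
  shows "emeasure (slice_measure 0 (\<kappa> - 1)) {u. u * (1 - u\<^sup>2) powr \<kappa> < \<epsilon>}
    \<le> ennreal ((4/3 * (4/3) powr \<kappa> + 2 / \<kappa>) * \<epsilon>)"
proof -
  \<comment> \<open>For u \<le> 1/2 the factor (1 - u^2) powr \<kappa> is at least (3/4) powr
    \<kappa>, so the sublevel condition forces u < r.\<close>
  define r where "r = (4/3) powr \<kappa> * \<epsilon>"
  have r: "r > 0" using \<epsilon> by (simp add: r_def)
  \<comment> \<open>Chosen so that (1 - u^2) powr \<kappa> < 2 \<epsilon> reads 1 - u^2 < v, that
    is, u above \<open>a\<close>. The truncation by \<open>max 0\<close> covers v \<ge> 1, where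
    this is no restriction.\<close>
  define v where "v = (2 * \<epsilon>) powr (1 / \<kappa>)"
  have v: "v > 0" "v powr \<kappa> = 2 * \<epsilon>" using \<epsilon> \<kappa> by (auto simp: v_def powr_powr)
  define a where "a = sqrt (max 0 (1 - v))"
  have a: "0 \<le> a" "a \<le> 1" "1 - a\<^sup>2 = min 1 v" using v by (auto simp: a_def max_def min_def)
  let ?E = "{u. u * (1 - u\<^sup>2) powr \<kappa> < \<epsilon>}"
  have [measurable]: "?E \<in> sets borel" by measurable
  have bound: "ennreal (u powr 0 * (1 - u\<^sup>2) powr (\<kappa> - 1)) * indicator ?E u * indicator {0<..<1} u
      \<le> ennreal (4/3) * indicator {0..r} u + ennreal (2 * u * (1 - u\<^sup>2) powr (\<kappa> - 1)) * indicator {a..1} u" for u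
  proof (cases "u \<in> ?E \<and> 0 < u \<and> u < 1")
    case True
    then have u: "0 < u" "u < 1" "u * (1 - u\<^sup>2) powr \<kappa> < \<epsilon>" by auto
    note pos = one_minus_square_bounds[OF u(1,2)]
    show ?thesis
    proof (cases "u \<le> 1/2")
      case True
      have "u\<^sup>2 \<le> (1/2)\<^sup>2" using True u by (intro power_mono) auto
      then have q: "3/4 \<le> 1 - u\<^sup>2" by (simp add: power2_eq_square)
      have "(3/4) powr \<kappa> \<le> (1 - u\<^sup>2) powr \<kappa>" using q \<kappa> by (intro powr_mono2) auto
      then have small: "u * (3/4) powr \<kappa> < \<epsilon>" using u by (smt (verit) mult_left_mono)
      have one: "(3/4::real) powr \<kappa> * (4/3) powr \<kappa> = 1" by (simp flip: powr_mult)
      have "u = u * ((3/4) powr \<kappa> * (4/3) powr \<kappa>)" by (simp only: one mult_1_right)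
      also have "\<dots> = u * (3/4) powr \<kappa> * (4/3) powr \<kappa>" by (rule mult.assoc[symmetric])
      also have "\<dots> < \<epsilon> * (4/3) powr \<kappa>" using small by (rule mult_strict_right_mono) simp
      finally have "u < r" by (simp add: r_def mult.commute)
      moreover have "(1 - u\<^sup>2) powr (\<kappa> - 1) \<le> 4/3" using q pos \<kappa> by (intro powr_le_four_thirds) auto
      ultimately show ?thesis using u \<epsilon>
        by (intro order_trans[OF _ add_increasing2[OF zero_le order_refl]]) (auto simp: indicator_def intro: ennreal_leI)
    next
      case False
      have "(1 - u\<^sup>2) powr \<kappa> < 2 * \<epsilon>"
      proof -
        have "1/2 * (1 - u\<^sup>2) powr \<kappa> \<le> u * (1 - u\<^sup>2) powr \<kappa>"
          using False by (intro mult_right_mono) auto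
        then show ?thesis using u by linarith
      qed
      then have "(1 - u\<^sup>2) powr \<kappa> < v powr \<kappa>" by (simp add: v)
      then have "1 - u\<^sup>2 < v" using pos v \<kappa> by (meson not_less powr_mono2 less_imp_le)
      then have "a\<^sup>2 \<le> u\<^sup>2" using a(3) zero_le_power2[of u] by linarith
      then have "a \<le> u" using u a by (meson power2_le_imp_le less_imp_le)
      moreover have "(1 - u\<^sup>2) powr (\<kappa> - 1) \<le> 2 * u * (1 - u\<^sup>2) powr (\<kappa> - 1)"
        using mult_right_mono[of 1 "2 * u" "(1 - u\<^sup>2) powr (\<kappa> - 1)"] False by simp
      ultimately show ?thesis using u
        by (intro order_trans[OF _ add_increasing[OF zero_le order_refl]]) (auto simp: indicator_def intro: ennreal_leI)
    qed
  qed (auto simp: indicator_def)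
  have "emeasure (slice_measure 0 (\<kappa> - 1)) ?E
     \<le> (\<integral>\<^sup>+u. ennreal (4/3) * indicator {0..r} u + ennreal (2 * u * (1 - u\<^sup>2) powr (\<kappa> - 1)) * indicator {a..1} u \<partial>lborel)"
    by (subst emeasure_slice_measure) (auto intro!: nn_integral_mono bound[simplified])
  also have "\<dots> = (\<integral>\<^sup>+u. ennreal (4/3) * indicator {0..r} u \<partial>lborel)
      + (\<integral>\<^sup>+u. ennreal (2 * u * (1 - u\<^sup>2) powr (\<kappa> - 1)) * indicator {a..1} u \<partial>lborel)"
    by (intro nn_integral_add) auto
  also have "\<dots> = ennreal (4/3 * r) + ennreal (min 1 v powr \<kappa> / \<kappa>)"
    using r a \<kappa> by (simp add: nn_integral_end_segment nn_integral_cmult ennreal_mult[symmetric])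
  also have "\<dots> \<le> ennreal (4/3 * r) + ennreal (2 * \<epsilon> / \<kappa>)"
  proof -
    have "min 1 v powr \<kappa> \<le> v powr \<kappa>" using v \<kappa> by (intro powr_mono2) auto
    then show ?thesis using \<kappa> v by (intro add_left_mono ennreal_leI divide_right_mono) auto
  qed
  also have "\<dots> = ennreal ((4/3 * (4/3) powr \<kappa> + 2 / \<kappa>) * \<epsilon>)"
    using r \<epsilon> \<kappa> by (simp add: ennreal_plus[symmetric] r_def algebra_simps del: ennreal_plus)
  finally show ?thesis .
qed

text \<open>The function of the sublevel bound never exceeds 1 on (0,1), so its sublevel set at 2
  carries all the mass.\<close>

lemma finite_slice_measure:
  assumes \<kappa>: "\<kappa> > 0"
  shows "finite_measure (slice_measure 0 (\<kappa> - 1))"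
proof
  let ?\<Lambda> = "slice_measure 0 (\<kappa> - 1)"
  have "emeasure ?\<Lambda> UNIV = emeasure ?\<Lambda> {u. u * (1 - u\<^sup>2) powr \<kappa> < 2}"
  proof (subst (1 2) emeasure_slice_measure)
    have "u * (1 - u\<^sup>2) powr \<kappa> < 2" if "0 < u" "u < 1" for u :: real
    proof -
      have "(1 - u\<^sup>2) powr \<kappa> \<le> 1"
        using one_minus_square_bounds[OF that] \<kappa> by (intro powr_le1) auto
      then have "u * (1 - u\<^sup>2) powr \<kappa> \<le> 1 * 1" using that by (intro mult_mono) auto
      then show ?thesis by simp
    qed
    then show "(\<integral>\<^sup>+t. ennreal (t powr 0 * (1 - t\<^sup>2) powr (\<kappa> - 1)) * indicator UNIV t * indicator {0<..<1} t \<partial>lborel)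
       = (\<integral>\<^sup>+t. ennreal (t powr 0 * (1 - t\<^sup>2) powr (\<kappa> - 1)) * indicator {u. u * (1 - u\<^sup>2) powr \<kappa> < 2} t * indicator {0<..<1} t \<partial>lborel)"
      by (intro nn_integral_cong) (auto simp: indicator_def)
  qed auto
  also have "\<dots> \<le> ennreal ((4/3 * (4/3) powr \<kappa> + 2 / \<kappa>) * 2)"
    using \<kappa> by (intro emeasure_slice_sublevel) auto
  finally show "emeasure ?\<Lambda> (space ?\<Lambda>) \<noteq> \<infinity>"
    by (auto simp: top_unique)
qed

text \<open>The density of the right-hand measure with respect to the left-hand one is at least
  the (p - 1)-st power of q u = u * (1 - u^2) powr \<kappa>, and the first measure gives mass O(\<epsilon>)
  to the set where q < \<epsilon>.  A set of mass m thus has half its mass where q is at least of order m.\<close>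
lemma slice_measure_restricted_type:
  fixes \<kappa> p a :: real
  assumes \<kappa>: "\<kappa> > 0" and p: "p \<ge> 1" "p \<ge> 1 + a"
  obtains c where "c > 0"
    and "\<And>E. E \<in> sets borel \<Longrightarrow>
      ennreal (c * measure (slice_measure 0 (\<kappa> - 1)) E powr p) \<le> emeasure (slice_measure a (p * \<kappa> - 1)) E"
proof -
  let ?\<Lambda> = "slice_measure 0 (\<kappa> - 1)" and ?N = "slice_measure a (p * \<kappa> - 1)"
  interpret \<Lambda>: finite_measure ?\<Lambda> using \<kappa> by (rule finite_slice_measure)
  define q where "q u = u * (1 - u\<^sup>2) powr \<kappa>" for u :: real
  have [measurable]: "q \<in> borel_measurable borel" unfolding q_def by measurable
  define C where "C = 4/3 * (4/3) powr \<kappa> + 2 / \<kappa>"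
  have C: "C > 0" using \<kappa> by (simp add: C_def add_pos_pos)
  \<comment> \<open>With \<epsilon> = m / (2 C), this is the constant for which c * m powr p equals
    \<epsilon> powr (p - 1) * (m / 2).\<close>
  define c where "c = (1 / (2 * C)) powr (p - 1) / 2"
  show ?thesis
  proof
    show "c > 0" using C by (simp add: c_def)
    fix E :: "real set" assume E [measurable]: "E \<in> sets borel"
    define m where "m = measure ?\<Lambda> E"
    show "ennreal (c * measure ?\<Lambda> E powr p) \<le> emeasure ?N E"
    proof (cases "m = 0")
      case True
      then show ?thesis by (simp add: m_def)
    next
      case False
      then have m: "m > 0" by (simp add: m_def zero_less_measure_iff)
      \<comment> \<open>The sublevel bound C * \<epsilon> is then m / 2, so at least half the mass
        of \<open>E\<close> survives in \<open>F\<close>.\<close>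
      define \<epsilon> where "\<epsilon> = m / (2 * C)"
      have \<epsilon>: "\<epsilon> > 0" using m C by (simp add: \<epsilon>_def)
      define F where "F = E \<inter> {u. \<epsilon> \<le> q u}"
      have F [measurable]: "F \<in> sets borel" unfolding F_def by measurable
      have low: "measure ?\<Lambda> {u. q u < \<epsilon>} \<le> m / 2"
      proof -
        have "emeasure ?\<Lambda> {u. q u < \<epsilon>} \<le> ennreal (C * \<epsilon>)"
          unfolding q_def C_def using \<kappa> \<epsilon> by (rule emeasure_slice_sublevel)
        also have "C * \<epsilon> = m / 2" using C by (simp add: \<epsilon>_def)
        finally show ?thesis using m by (simp add: \<Lambda>.emeasure_eq_measure)
      qed
      have "m \<le> measure ?\<Lambda> (F \<union> {u. q u < \<epsilon>})"
        unfolding m_def by (rule \<Lambda>.finite_measure_mono) (auto simp: F_def)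
      also have "\<dots> \<le> measure ?\<Lambda> F + measure ?\<Lambda> {u. q u < \<epsilon>}"
        by (rule measure_Un_le) auto
      finally have half: "m / 2 \<le> measure ?\<Lambda> F" using low by linarith
      have "c * m powr p = \<epsilon> powr (p - 1) * (m / 2)"
      proof -
        have "m powr p = m powr (p - 1) * m" using m by (simp add: powr_diff)
        then show ?thesis using m C by (simp add: c_def \<epsilon>_def powr_divide field_simps)
      qed
      also have "\<dots> \<le> \<epsilon> powr (p - 1) * measure ?\<Lambda> F"
        using half by (intro mult_left_mono) auto
      finally have "ennreal (c * m powr p) \<le> ennreal (\<epsilon> powr (p - 1)) * emeasure ?\<Lambda> F"
        by (simp add: \<Lambda>.emeasure_eq_measure ennreal_mult[symmetric] ennreal_leI)
      also have "\<dots> = (\<integral>\<^sup>+t. ennreal (\<epsilon> powr (p - 1)) * (ennreal (t powr 0 * (1 - t\<^sup>2) powr (\<kappa> - 1)) * indicator F t * indicator {0<..<1} t) \<partial>lborel)"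
        by (subst emeasure_slice_measure) (auto simp: nn_integral_cmult)
      also have "\<dots> \<le> (\<integral>\<^sup>+t. ennreal (t powr a * (1 - t\<^sup>2) powr (p * \<kappa> - 1)) * indicator E t * indicator {0<..<1} t \<partial>lborel)"
      proof (rule nn_integral_mono)
        fix t :: real
        show "ennreal (\<epsilon> powr (p - 1)) * (ennreal (t powr 0 * (1 - t\<^sup>2) powr (\<kappa> - 1)) * indicator F t * indicator {0<..<1} t)
          \<le> ennreal (t powr a * (1 - t\<^sup>2) powr (p * \<kappa> - 1)) * indicator E t * indicator {0<..<1} t"
        proof (cases "t \<in> F \<and> 0 < t \<and> t < 1")
          case True
          then have t: "0 < t" "t < 1" "\<epsilon> \<le> q t" "t \<in> E" by (auto simp: F_def)
          note pos = one_minus_square_bounds[OF t(1,2)]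
          have "\<epsilon> powr (p - 1) * (1 - t\<^sup>2) powr (\<kappa> - 1) \<le> q t powr (p - 1) * (1 - t\<^sup>2) powr (\<kappa> - 1)"
            using \<epsilon> t p by (intro mult_right_mono powr_mono2) auto
          also have "q t powr (p - 1) = t powr (p - 1) * (1 - t\<^sup>2) powr (\<kappa> * (p - 1))"
            using pos t by (simp add: q_def powr_mult powr_powr)
          also have "\<dots> * (1 - t\<^sup>2) powr (\<kappa> - 1) = t powr (p - 1) * (1 - t\<^sup>2) powr (p * \<kappa> - 1)"
            unfolding mult.assoc powr_add[symmetric] by (simp add: algebra_simps)
          \<comment> \<open>The condition p \<ge> 1 + a enters here: t < 1 and a \<le> p -
            1.\<close>
          also have "\<dots> \<le> t powr a * (1 - t\<^sup>2) powr (p * \<kappa> - 1)"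
            using t p by (intro mult_right_mono powr_mono') auto
          finally show ?thesis using True t by (simp add: ennreal_mult[symmetric] ennreal_leI)
        qed (auto simp: indicator_def)
      qed
      also have "\<dots> = emeasure ?N E" by (subst emeasure_slice_measure) auto
      finally show ?thesis by (simp add: m_def)
    qed
  qed
qed

text \<open>Substitute s = c t: the element dt and the power of t together give c powr (1 + a). The
  remaining factor can only grow, because 1 - (c t)^2 \<ge> 1 - t^2 and b \<ge> 0; for negative b
  this comparison would be reversed.\<close>

lemma slice_measure_dilation:
  fixes a b c :: real
  assumes c: "0 < c" "c \<le> 1" and b: "b \<ge> 0" and E [measurable]: "E \<in> sets borel"
  shows "ennreal (c powr (1 + a)) * emeasure (slice_measure a b) {t. c * t \<in> E} \<le> emeasure (slice_measure a b) E"
proof -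
  let ?w = "\<lambda>t. t powr a * (1 - t\<^sup>2) powr b"
  have E' [measurable]: "{t. c * t \<in> E} \<in> sets borel" by measurable
  have "ennreal (c powr (1 + a)) * emeasure (slice_measure a b) {t. c * t \<in> E}
     = c * (\<integral>\<^sup>+t. ennreal (c powr a) * (ennreal (?w t) * indicator {t. c * t \<in> E} t * indicator {0<..<1} t) \<partial>lborel)"
    using c by (subst emeasure_slice_measure) (auto simp: nn_integral_cmult powr_add ennreal_mult mult.assoc)
  also have "\<dots> \<le> c * (\<integral>\<^sup>+t. ennreal (?w (0 + c * t)) * indicator E (0 + c * t) * indicator {0<..<1} (0 + c * t) \<partial>lborel)"
  proof (intro mult_left_mono nn_integral_mono)
    fix t :: real
    show "ennreal (c powr a) * (ennreal (?w t) * indicator {t. c * t \<in> E} t * indicator {0<..<1} t)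
       \<le> ennreal (?w (0 + c * t)) * indicator E (0 + c * t) * indicator {0<..<1} (0 + c * t)"
    proof (cases "0 < t \<and> t < 1")
      case True
      then have t: "0 < t" "t < 1" by auto
      have ct: "c * t \<le> t" using t c by (simp add: mult_le_cancel_right1 mult_left_le_one_le)
      have "(c * t)\<^sup>2 \<le> t\<^sup>2" using ct t c by (intro power_mono) auto
      then have "(1 - t\<^sup>2) powr b \<le> (1 - (c * t)\<^sup>2) powr b"
        using one_minus_square_bounds[OF t] b by (intro powr_mono2) auto
      then have "c powr a * ?w t \<le> ?w (c * t)"
        using t c by (simp add: powr_mult mult_left_mono)
      then have "ennreal (c powr a) * ennreal (?w t) \<le> ennreal (?w (c * t))"
        by (simp add: ennreal_mult[symmetric] ennreal_leI)
      moreover have "c * t < 1" "0 < c * t" using le_less_trans[OF ct] t c by auto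
      ultimately show ?thesis using t by (simp add: indicator_def)
    qed (auto simp: indicator_def)
  qed auto
  also have "\<dots> = emeasure (slice_measure a b) E"
    using c by (subst emeasure_slice_measure, simp, subst nn_integral_real_affine[where c = c and t = 0]) auto
  finally show ?thesis .
qed

lemma enn_powr_ge:
  assumes "p > 0" "x \<ge> 0" "ennreal (x powr p) \<le> y"
  shows "ennreal x \<le> enn_powr y (1 / p)"
proof (cases "y = top")
  case True
  then show ?thesis by (simp add: enn_powr_def)
next
  case False
  then obtain z where z: "y = ennreal z" "z \<ge> 0" by (cases y) auto
  then have "x powr p \<le> z" using assms by simp
  then have "(x powr p) powr (1 / p) \<le> z powr (1 / p)" using assms by (intro powr_mono2) auto
  then show ?thesis using assms z False by (simp add: enn_powr_def powr_powr ennreal_leI)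
qed

text \<open>The inequality at c = 1, applied to the pulled-back set, is followed by the dilation
  bound, and then a p-th root is taken. The factor \<open>K\<close> makes room for the slice
  constant of the large sphere, and c0 depends neither on c nor on \<open>E\<close>.\<close>

lemma slice_measure_dilated_restricted_type:
  fixes \<kappa> p a K :: real
  assumes \<kappa>: "\<kappa> > 0" and p: "p \<ge> 1" "p \<ge> 1 + a" "p * \<kappa> \<ge> 1" and K: "K > 0"
  obtains c0 where "c0 > 0"
    and "\<And>c E. \<lbrakk>0 < c; c \<le> 1; E \<in> sets borel\<rbrakk> \<Longrightarrow>
      ennreal (c0 * c powr ((1 + a) / p)) * emeasure (slice_measure 0 (\<kappa> - 1)) {t. c * t \<in> E}
        \<le> enn_powr (ennreal K * emeasure (slice_measure a (p * \<kappa> - 1)) E) (1 / p)"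
proof -
  let ?\<Lambda> = "slice_measure 0 (\<kappa> - 1)" and ?N = "slice_measure a (p * \<kappa> - 1)"
  interpret \<Lambda>: finite_measure ?\<Lambda> using \<kappa> by (rule finite_slice_measure)
  obtain c1 where c1: "c1 > 0"
    and type: "\<And>E. E \<in> sets borel \<Longrightarrow> ennreal (c1 * measure ?\<Lambda> E powr p) \<le> emeasure ?N E"
    using slice_measure_restricted_type[OF \<kappa> p(1,2)] by metis
  show ?thesis
  proof
    show "(K * c1) powr (1 / p) > 0" using K c1 by simp
    fix c :: real and E :: "real set"
    assume c: "0 < c" "c \<le> 1" and E [measurable]: "E \<in> sets borel"
    define E' where "E' = {t. c * t \<in> E}"
    have [measurable]: "E' \<in> sets borel" unfolding E'_def by measurable
    define m where "m = measure ?\<Lambda> E'"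
    have m: "m \<ge> 0" by (simp add: m_def)
    have "((K * c1) powr (1 / p) * c powr ((1 + a) / p) * m) powr p = K * c powr (1 + a) * (c1 * m powr p)"
      using K c1 c m p by (simp add: powr_mult powr_powr)
    then have "ennreal (((K * c1) powr (1 / p) * c powr ((1 + a) / p) * m) powr p)
       = ennreal K * (ennreal (c powr (1 + a)) * ennreal (c1 * m powr p))"
      using K c1 by (simp add: ennreal_mult[symmetric] mult.assoc)
    also have "\<dots> \<le> ennreal K * (ennreal (c powr (1 + a)) * emeasure ?N E')"
      unfolding m_def by (intro mult_left_mono type) auto
    also have "\<dots> \<le> ennreal K * emeasure ?N E"
      unfolding E'_def using c p by (intro mult_left_mono slice_measure_dilation) auto
    finally have "ennreal ((K * c1) powr (1 / p) * c powr ((1 + a) / p) * m) \<le> enn_powr (ennreal K * emeasure ?N E) (1 / p)"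
      using p m by (intro enn_powr_ge) auto
    then show "ennreal ((K * c1) powr (1 / p) * c powr ((1 + a) / p)) * emeasure ?\<Lambda> {t. c * t \<in> E}
        \<le> enn_powr (ennreal K * emeasure ?N E) (1 / p)"
      using m by (simp add: \<Lambda>.emeasure_eq_measure m_def E'_def ennreal_mult[symmetric])
  qed
qed

section \<open>Great subspheres and the sufficient condition\<close>

lemma nn_integral_sphere_slice_measure:
  fixes e :: "real^'n" and G :: "real \<Rightarrow> ennreal"
  assumes e: "norm e = 1" and N: "CARD('n) \<ge> 2" and G [measurable]: "G \<in> borel_measurable borel"
  shows "(\<integral>\<^sup>+y. G \<bar>y \<bullet> e\<bar> \<partial>sphere_measure) =
    ennreal (slice_const CARD('n)) * (\<integral>\<^sup>+t. G t \<partial>slice_measure 0 ((real CARD('n) - 3) / 2))"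
  unfolding nn_integral_sphere_slice[OF assms] nn_integral_slice_measure[OF G]
  by (rule arg_cong[where f = "(*) _"], rule nn_integral_cong) (auto simp: indicator_def mult.commute)

lemma sdist_sphere:
  fixes e x :: "'a::euclidean_space"
  assumes "norm e = 1" "x \<in> sphere 0 1"
  shows "cos (sdist e x) = x \<bullet> e" "sin (sdist e x) = sqrt (1 - (x \<bullet> e)\<^sup>2)"
proof -
  have "\<bar>e \<bullet> x\<bar> \<le> 1" using Cauchy_Schwarz_ineq2[of e x] assms by simp
  then show "cos (sdist e x) = x \<bullet> e" "sin (sdist e x) = sqrt (1 - (x \<bullet> e)\<^sup>2)"
    by (auto simp: sdist_def sin_arccos abs_le_iff inner_commute)
qed

lemma space_weighted_sphere_measure [simp]: "space (weighted_sphere_measure e a1 a2) = sphere 0 1"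
  by (simp add: weighted_sphere_measure_def)

text \<open>At height t the sine of the distance is sqrt (1 - t^2), so the weight contributes a1/2
  to the exponent (N - 3)/2 of the plain slice formula.\<close>

lemma emeasure_weighted_sphere_slice:
  fixes e :: "real^'n"
  assumes e: "norm e = 1" and N: "CARD('n) \<ge> 2" and E [measurable]: "E \<in> sets borel"
  shows "emeasure (weighted_sphere_measure e a1 a2) {x \<in> sphere 0 1. \<bar>x \<bullet> e\<bar> \<in> E} =
    ennreal (slice_const CARD('n)) * emeasure (slice_measure a2 ((a1 + real CARD('n) - 3) / 2)) E"
proof -
  define w where "w t = ennreal (sqrt (1 - t\<^sup>2) powr a1 * t powr a2)" for t :: real
  have [measurable]: "w \<in> borel_measurable borel" unfolding w_def by measurable
  let ?W = "\<lambda>x. ennreal (sin (sdist e x) powr a1 * \<bar>cos (sdist e x)\<bar> powr a2)"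
  have W: "?W x = w \<bar>x \<bullet> e\<bar>" if "x \<in> sphere 0 1" for x
    unfolding w_def using sdist_sphere[OF e that] by simp
  have wm: "(\<lambda>x. w \<bar>x \<bullet> e\<bar>) \<in> borel_measurable sphere_measure"
    by (subst measurable_cong_sets[OF sets_sphere_measure refl], rule measurable_restrict_space1) measurable
  have S: "{x \<in> sphere 0 1. \<bar>x \<bullet> e\<bar> \<in> E} \<in> sets sphere_measure"
  proof -
    have "{x. \<bar>x \<bullet> e\<bar> \<in> E} \<in> sets borel" by measurable
    then show ?thesis unfolding sets_sphere_measure sets_restrict_space by auto
  qed
  have Wm: "?W \<in> borel_measurable sphere_measure"
    using wm W by (subst measurable_cong[where g = "\<lambda>x. w \<bar>x \<bullet> e\<bar>"]) auto
  have "emeasure (weighted_sphere_measure e a1 a2) {x \<in> sphere 0 1. \<bar>x \<bullet> e\<bar> \<in> E}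
      = (\<integral>\<^sup>+x. ?W x * indicator {x \<in> sphere 0 1. \<bar>x \<bullet> e\<bar> \<in> E} x \<partial>sphere_measure)"
    unfolding weighted_sphere_measure_def using Wm S by (rule emeasure_density)
  also have "\<dots> = (\<integral>\<^sup>+x. w \<bar>x \<bullet> e\<bar> * indicator E \<bar>x \<bullet> e\<bar> \<partial>sphere_measure)"
    using W by (intro nn_integral_cong) (auto simp: indicator_def)
  also have "\<dots> = ennreal (slice_const CARD('n)) * (\<integral>\<^sup>+t. w t * indicator E t \<partial>slice_measure 0 ((real CARD('n) - 3) / 2))"
    by (rule nn_integral_sphere_slice_measure[OF e N]) measurable
  also have "(\<integral>\<^sup>+t. w t * indicator E t \<partial>slice_measure 0 ((real CARD('n) - 3) / 2))
     = emeasure (slice_measure a2 ((a1 + real CARD('n) - 3) / 2)) E"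
  proof (subst nn_integral_slice_measure, measurable, subst emeasure_slice_measure[OF E], rule nn_integral_cong)
    fix t :: real
    show "ennreal (t powr 0 * (1 - t\<^sup>2) powr ((real CARD('n) - 3) / 2)) * (w t * indicator E t) * indicator {0<..<1} t
      = ennreal (t powr a2 * (1 - t\<^sup>2) powr ((a1 + real CARD('n) - 3) / 2)) * indicator E t * indicator {0<..<1} t"
    proof (cases "0 < t \<and> t < 1")
      case True
      then have pos: "0 < 1 - t\<^sup>2" using one_minus_square_bounds by blast
      have "sqrt (1 - t\<^sup>2) powr a1 = (1 - t\<^sup>2) powr (a1 / 2)"
        using pos by (simp add: powr_half_sqrt[symmetric] powr_powr)
      then have "(1 - t\<^sup>2) powr ((real CARD('n) - 3) / 2) * (sqrt (1 - t\<^sup>2) powr a1 * t powr a2)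
         = t powr a2 * (1 - t\<^sup>2) powr ((a1 + real CARD('n) - 3) / 2)"
        by (simp add: mult_ac powr_add[symmetric] add_divide_distrib[symmetric] add_diff_eq)
      then show ?thesis using True
        by (simp add: w_def mult.assoc[symmetric] ennreal_mult[symmetric]) (simp add: mult.commute)
    qed simp
  qed
  finally show ?thesis .
qed

text \<open>The profile supplied by \<open>even_radial\<close> need not be measurable. A measurable
  one is read off by following f along a quarter of a great circle from the equator to e.\<close>

lemma even_radial_profile:
  fixes f :: "real^'n \<Rightarrow> real" and e :: "real^'n"
  assumes e: "norm e = 1" and N: "CARD('n) \<ge> 2"
    and f: "f \<in> borel_measurable sphere_measure" and rad: "even_radial e f"
  obtains F where "F \<in> borel_measurable borel" and "\<And>x. x \<in> sphere 0 1 \<Longrightarrow> f x = F \<bar>x \<bullet> e\<bar>"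
proof -
  obtain F0 where F0: "\<And>x. x \<in> sphere 0 1 \<Longrightarrow> f x = F0 \<bar>x \<bullet> e\<bar>"
    using rad by (auto simp: even_radial_def)
  obtain z where z: "z \<noteq> 0" "orthogonal e z"
    using orthogonal_to_vector_exists[of e] N by auto
  define e' where "e' = z /\<^sub>R norm z"
  have e': "norm e' = 1" "e \<bullet> e' = 0" "e' \<bullet> e = 0"
    using z by (auto simp: e'_def orthogonal_def inner_commute)
  \<comment> \<open>Clamping to [0,1] keeps the curve on the sphere for every real t, since
    measurability of f is known only there.\<close>
  define r where "r t = max 0 (min 1 t)" for t :: real
  have r: "0 \<le> r t" "r t \<le> 1" for t by (auto simp: r_def)
  define x where "x t = r t *\<^sub>R e + sqrt (1 - (r t)\<^sup>2) *\<^sub>R e'" for t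
  have xe: "x t \<bullet> e = r t" for t
    using e e' by (simp add: x_def inner_add_left dot_square_norm)
  have "x t \<bullet> x t = 1" for t
  proof -
    have "x t \<bullet> x t = (r t)\<^sup>2 + (sqrt (1 - (r t)\<^sup>2))\<^sup>2"
    proof -
      have "e \<bullet> e = 1" "e' \<bullet> e' = 1" using e e' by (auto simp: dot_square_norm)
      then show ?thesis using e' by (simp add: x_def inner_add_left inner_add_right power2_eq_square)
    qed
    also have "\<dots> = 1" using r[of t] by (simp add: power_le_one)
    finally show ?thesis .
  qed
  then have xs: "x t \<in> sphere 0 1" for t by (simp add: norm_eq_sqrt_inner)
  have "x \<in> borel_measurable borel" unfolding x_def r_def by measurable
  then have "x \<in> measurable borel (restrict_space borel (sphere 0 1))"
    using xs by (intro measurable_restrict_space2) auto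
  then have "(\<lambda>t. f (x t)) \<in> borel_measurable borel"
    using f by (intro measurable_compose[of x borel "restrict_space borel (sphere 0 1)" f])
       (auto simp: measurable_cong_sets[OF sets_sphere_measure refl])
  moreover have "f y = f (x \<bar>y \<bullet> e\<bar>)" if y: "y \<in> sphere 0 1" for y
  proof -
    have "\<bar>y \<bullet> e\<bar> \<le> 1" using Cauchy_Schwarz_ineq2[of y e] y e by simp
    then have "r \<bar>y \<bullet> e\<bar> = \<bar>y \<bullet> e\<bar>" by (simp add: r_def)
    then show ?thesis using F0[OF y] F0[OF xs, of "\<bar>y \<bullet> e\<bar>"] by (simp add: xe)
  qed
  ultimately show ?thesis by (rule that)
qed

text \<open>Injectivity gives the column space the dimension of the parameter space, so an isometry
  onto it exists and the choice in \<open>param_iso\<close> is meaningful.\<close>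

lemma param_iso_range:
  fixes A :: "real^'k^'j"
  assumes "inj (\<lambda>y. A *v y)"
  defines "T \<equiv> param_iso (range (\<lambda>y. A *v y)) :: real^'k \<Rightarrow> real^'j"
  shows "linear T" "norm (T y) = norm y" "range T = range (\<lambda>y. A *v y)"
proof -
  let ?V = "range (\<lambda>y. A *v y)"
  have lin: "linear (\<lambda>y. A *v y)" by simp
  have sub: "subspace ?V" using lin by (intro linear_subspace_image) auto
  have "dim ?V = dim (UNIV :: (real^'k) set)"
    using assms(1) lin by (intro dim_image_eq) auto
  then obtain f :: "real^'k \<Rightarrow> real^'j" where "linear f" "f ` UNIV = ?V" "\<And>x. norm (f x) = norm x"
    using isometries_subspaces[of "UNIV :: (real^'k) set" ?V] sub by (metis UNIV_I subspace_UNIV)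
  then have "\<exists>T :: real^'k \<Rightarrow> real^'j. linear T \<and> (\<forall>y. norm (T y) = norm y) \<and> range T = ?V"
    by blast
  from someI_ex[OF this] show "linear T" "norm (T y) = norm y" "range T = ?V"
    unfolding T_def param_iso_def by blast+
qed

text \<open>Since arccos is decreasing, the infimum is attained where y . w is largest on the unit
  sphere, at y = w / |w|. If w = 0, every unit vector serves.\<close>

lemma sdist_set_plane:
  fixes T :: "real^'k \<Rightarrow> real^'j"
  assumes normT: "\<And>y. norm (T y) = norm y" and w: "\<And>y. T y \<bullet> e = y \<bullet> w" and w1: "norm w \<le> 1"
  shows "sdist_set e (range T \<inter> sphere 0 1) = arccos (norm w)"
proof -
  have im: "sdist e ` (range T \<inter> sphere 0 1) = (\<lambda>y. arccos (y \<bullet> w)) ` sphere 0 1"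
    by (force simp: sdist_def w[symmetric] inner_commute normT image_iff)
  have bound: "\<bar>y \<bullet> w\<bar> \<le> norm w" if "norm y = 1" for y
    using Cauchy_Schwarz_ineq2[of y w] that by simp
  show ?thesis unfolding sdist_set_def im
  proof (rule cInf_eq_minimum)
    show "arccos (norm w) \<in> (\<lambda>y. arccos (y \<bullet> w)) ` sphere 0 1"
    proof (cases "w = 0")
      case True
      then show ?thesis by (auto intro!: image_eqI[of _ _ "axis undefined 1"])
    next
      case False
      then have "(w /\<^sub>R norm w) \<bullet> w = norm w" by (simp add: dot_square_norm power2_eq_square)
      then show ?thesis using False by (auto intro!: image_eqI[of _ _ "w /\<^sub>R norm w"])
    qed
    fix z assume "z \<in> (\<lambda>y. arccos (y \<bullet> w)) ` sphere 0 1"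
    then obtain y where "norm y = 1" "z = arccos (y \<bullet> w)" by auto
    then show "arccos (norm w) \<le> z"
      using bound[of y] w1 by (auto intro!: arccos_le_arccos)
  qed
qed

text \<open>The vector w is the orthogonal projection of e to the plane, pulled back to the parameter space.\<close>
lemma plane_direction:
  fixes A :: "real^'k^'j" and e :: "real^'j"
  assumes inj: "inj (\<lambda>y. A *v y)" and e: "norm e = 1"
  defines "V \<equiv> range (\<lambda>y. A *v y)"
  obtains w :: "real^'k" where "\<And>y. param_iso V y \<bullet> e = y \<bullet> w" "norm w \<le> 1"
    "sdist_set e (V \<inter> sphere 0 1) = arccos (norm w)"
proof
  note T = param_iso_range[OF inj, folded V_def]
  define w :: "real^'k" where "w = adjoint (param_iso V) e"
  show w: "param_iso V y \<bullet> e = y \<bullet> w" for y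
    using adjoint_works[OF T(1)] by (simp add: w_def)
  \<comment> \<open>Evaluating at y = w and using that the parametrisation is isometric gives |w|^2
    \<le> |w|.\<close>
  have "norm w * norm w = param_iso V w \<bullet> e" by (simp add: w dot_square_norm power2_eq_square)
  also have "\<dots> \<le> norm w" using Cauchy_Schwarz_ineq2[of "param_iso V w" e] T(2) e by simp
  finally show w1: "norm w \<le> 1" by (cases "w = 0") auto
  show "sdist_set e (V \<inter> sphere 0 1) = arccos (norm w)"
    using sdist_set_plane[OF T(2) w w1] by (simp add: T(3))
qed

text \<open>Here the cosine enters as a dilation: with w = |w| u and u a unit vector, y . w is |w|
  times the height of y over the equator of u.\<close>

lemma nn_integral_sphere_dilated_slice:
  fixes w :: "real^'k" and G :: "real \<Rightarrow> ennreal"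
  assumes w: "w \<noteq> 0" and N: "CARD('k) \<ge> 2" and G [measurable]: "G \<in> borel_measurable borel"
  shows "(\<integral>\<^sup>+y. G \<bar>y \<bullet> w\<bar> \<partial>sphere_measure) =
    ennreal (slice_const CARD('k)) * (\<integral>\<^sup>+t. G (norm w * t) \<partial>slice_measure 0 ((real CARD('k) - 3) / 2))"
proof -
  have "(\<integral>\<^sup>+y. G \<bar>y \<bullet> w\<bar> \<partial>sphere_measure) = (\<integral>\<^sup>+y. G (norm w * \<bar>y \<bullet> (w /\<^sub>R norm w)\<bar>) \<partial>sphere_measure)"
    using w by (intro nn_integral_cong) (simp add: abs_mult mult.assoc[symmetric])
  also have "\<dots> = ennreal (slice_const CARD('k)) * (\<integral>\<^sup>+t. G (norm w * t) \<partial>slice_measure 0 ((real CARD('k) - 3) / 2))"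
    using w by (intro nn_integral_sphere_slice_measure[OF _ N]) auto
  finally show ?thesis .
qed

lemma borel_measurable_sphere_measure_inner:
  fixes w :: "'a::euclidean_space"
  assumes [measurable]: "G \<in> borel_measurable borel"
  shows "(\<lambda>y. G \<bar>y \<bullet> w\<bar>) \<in> borel_measurable sphere_measure"
  by (subst measurable_cong_sets[OF sets_sphere_measure refl], rule measurable_restrict_space1) measurable

text \<open>By the layer-cake formula the transform of |f| is an integral over the levels s of the
  mass of {t. s < |F (c t)|}. Bounding each level by the inequality for indicators sums to exactly
  the integral in the Lorentz norm.\<close>

lemma radon_estimate_sufficient:
  fixes e :: "real^'j" and \<kappa> a1 a2 p \<gamma> :: real
  assumes e: "norm e = 1" and J: "CARD('j) \<ge> 2" and K: "CARD('k::finite) \<ge> 2"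
    and \<kappa>: "real CARD('k) - 1 = 2 * \<kappa>" and a1: "a1 + real CARD('j) - 1 = 2 * (p * \<kappa>)"
    and p: "p \<ge> 1" "p \<ge> 1 + a2" "p * \<kappa> \<ge> 1" and \<gamma>: "\<gamma> \<ge> (1 + a2) / p"
  shows "radon_estimate TYPE('k) e a1 a2 p \<gamma>"
proof -
  have \<kappa>_pos: "\<kappa> > 0" using K \<kappa> by linarith
  let ?\<Lambda> = "slice_measure 0 (\<kappa> - 1)" and ?N = "slice_measure a2 (p * \<kappa> - 1)"
  let ?\<mu> = "weighted_sphere_measure e a1 a2"
  define KJ KK where "KJ = slice_const CARD('j)" and "KK = slice_const CARD('k)"
  have KJ: "KJ > 0" and KK: "KK > 0" using J K by (auto simp: KJ_def KK_def slice_const_pos)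
  have exp1: "(real CARD('k) - 3) / 2 = \<kappa> - 1" using \<kappa> by (simp add: field_simps)
  have exp2: "(a1 + real CARD('j) - 3) / 2 = p * \<kappa> - 1" using a1 by (simp add: field_simps)
  obtain c0 where c0: "c0 > 0" and type: "\<And>c E. \<lbrakk>0 < c; c \<le> 1; E \<in> sets borel\<rbrakk> \<Longrightarrow>
      ennreal (c0 * c powr ((1 + a2) / p)) * emeasure ?\<Lambda> {t. c * t \<in> E}
        \<le> enn_powr (ennreal KJ * emeasure ?N E) (1 / p)"
    using slice_measure_dilated_restricted_type[OF \<kappa>_pos p KJ] by metis
  \<comment> \<open>The slice constant of the small sphere over that of the indicator inequality;
    dividing by p cancels the factor p of the Lorentz norm.\<close>
  define C where "C = KK / (c0 * p)"
  have C: "C \<ge> 0" using KK c0 p by (simp add: C_def)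
  interpret \<Lambda>: finite_measure ?\<Lambda> using \<kappa>_pos by (rule finite_slice_measure)
  interpret P: pair_sigma_finite ?\<Lambda> "lborel :: real measure"
    by (intro pair_sigma_finite.intro \<Lambda>.sigma_finite_measure_axioms lborel.sigma_finite_measure_axioms)
  show ?thesis unfolding radon_estimate_def
  proof (intro exI[of _ C] conjI allI impI C)
    fix f :: "real^'j \<Rightarrow> real"
    assume f: "f \<in> borel_measurable sphere_measure" and rad: "even_radial e f"
      and fin: "lorentz_norm ?\<mu> p f < \<infinity>"
    obtain F where F [measurable]: "F \<in> borel_measurable borel"
      and fF: "\<And>x. x \<in> sphere 0 1 \<Longrightarrow> f x = F \<bar>x \<bullet> e\<bar>"
      using even_radial_profile[OF e J f rad] by metis
    define L where "L = (\<integral>\<^sup>+ s\<in>{0..}. enn_powr (emeasure ?\<mu> {x\<in>space ?\<mu>. \<bar>f x\<bar> > s}) (1/p) \<partial>lborel)"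
    have lor: "lorentz_norm ?\<mu> p f = ennreal p * L" by (simp add: lorentz_norm_def L_def)
    have L_fin: "L < top" using fin p by (auto simp: lor ennreal_mult_less_top)
    \<comment> \<open>The bound is proved for every admissible plane, with no exceptional null
      set.\<close>
    show "AE_planes TYPE('k) e (\<lambda>V. radon_integrable TYPE('k) f V \<and>
       ennreal \<bar>cos (sdist_set e (V \<inter> sphere 0 1)) powr \<gamma> * radon TYPE('k) f V\<bar> \<le> ennreal C * lorentz_norm ?\<mu> p f)"
      unfolding AE_planes_def
    proof (rule AE_I2, rule impI)
      fix A :: "real^'k^'j"
      let ?V = "range (\<lambda>y. A *v y)"
      assume A: "inj (\<lambda>y. A *v y) \<and> sdist_set e (?V \<inter> sphere 0 1) < pi / 2"
      define T where "T = (param_iso ?V :: real^'k \<Rightarrow> real^'j)"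
      obtain w where w: "\<And>y. T y \<bullet> e = y \<bullet> w" "norm w \<le> 1"
        and dist: "sdist_set e (?V \<inter> sphere 0 1) = arccos (norm w)"
        using plane_direction[of A e] A e unfolding T_def by metis
      have normT: "norm (T y) = norm y" for y
        using A param_iso_range(2)[of A] by (simp add: T_def)
      define c where "c = norm w"
      \<comment> \<open>If c = 0, the distance would be arccos 0 = pi / 2, which is
        excluded.\<close>
      have "c \<noteq> 0" using A dist by (auto simp: c_def)
      then have c: "0 < c" "c \<le> 1" and w0: "w \<noteq> 0" using w by (auto simp: c_def)
      have cos: "cos (sdist_set e (?V \<inter> sphere 0 1)) = c"
        using c by (simp add: dist c_def[symmetric])
      have fT: "f (T y) = F \<bar>y \<bullet> w\<bar>" if "y \<in> sphere 0 1" for y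
        using fF[of "T y"] that by (simp add: normT w)
      have fT_meas: "(\<lambda>y. f (T y)) \<in> borel_measurable sphere_measure"
        using borel_measurable_sphere_measure_inner[OF F, of w] fT
        by (subst measurable_cong[where g = "\<lambda>y. F \<bar>y \<bullet> w\<bar>"]) auto
      define X where "X = (\<integral>\<^sup>+t. ennreal \<bar>F (c * t)\<bar> \<partial>?\<Lambda>)"
      have norm_int: "(\<integral>\<^sup>+y. ennreal (norm (f (T y))) \<partial>sphere_measure) = ennreal KK * X"
      proof -
        have "(\<integral>\<^sup>+y. ennreal (norm (f (T y))) \<partial>sphere_measure) = (\<integral>\<^sup>+y. ennreal \<bar>F \<bar>y \<bullet> w\<bar>\<bar> \<partial>sphere_measure)"
          using fT by (intro nn_integral_cong) simp
        also have "\<dots> = ennreal KK * X"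
          using nn_integral_sphere_dilated_slice[OF w0 K, of "\<lambda>t. ennreal \<bar>F t\<bar>"]
          by (simp add: exp1 KK_def X_def c_def)
        finally show ?thesis .
      qed
      define b where "b = c0 * c powr ((1 + a2) / p)"
      have b: "b > 0" using c0 c by (simp add: b_def)
      have level: "emeasure ?\<mu> {x\<in>space ?\<mu>. \<bar>f x\<bar> > s} = ennreal KJ * emeasure ?N {t. s < \<bar>F t\<bar>}" for s
      proof -
        have [measurable]: "{t. s < \<bar>F t\<bar>} \<in> sets borel" by measurable
        have "{x\<in>space ?\<mu>. \<bar>f x\<bar> > s} = {x \<in> sphere 0 1. \<bar>x \<bullet> e\<bar> \<in> {t. s < \<bar>F t\<bar>}}"
          using fF by auto
        then show ?thesis
          using emeasure_weighted_sphere_slice[OF e J, of "{t. s < \<bar>F t\<bar>}" a1 a2] by (simp only: exp2 KJ_def) simp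
      qed
      have "X = (\<integral>\<^sup>+t. (\<integral>\<^sup>+s. indicator {0..<\<bar>F (c * t)\<bar>} s \<partial>lborel) \<partial>?\<Lambda>)"
        unfolding X_def by (intro nn_integral_cong) simp
      also have "\<dots> = (\<integral>\<^sup>+t. (\<integral>\<^sup>+s. indicator {z. 0 \<le> snd z \<and> snd z < \<bar>F (c * fst z)\<bar>} (t, s) \<partial>lborel) \<partial>?\<Lambda>)"
        by (intro nn_integral_cong) (auto simp: indicator_def)
      also have "\<dots> = (\<integral>\<^sup>+s. (\<integral>\<^sup>+t. indicator {z. 0 \<le> snd z \<and> snd z < \<bar>F (c * fst z)\<bar>} (t, s) \<partial>?\<Lambda>) \<partial>lborel)"
        by (rule P.Fubini'[symmetric]) measurable
      finally have "ennreal b * X = (\<integral>\<^sup>+s. ennreal b * (\<integral>\<^sup>+t. indicator {z. 0 \<le> snd z \<and> snd z < \<bar>F (c * fst z)\<bar>} (t, s) \<partial>?\<Lambda>) \<partial>lborel)"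
        by (simp add: nn_integral_cmult)
      also have "\<dots> \<le> L"
        unfolding L_def level
      proof (rule nn_integral_mono)
        fix s :: real
        show "ennreal b * (\<integral>\<^sup>+t. indicator {z. 0 \<le> snd z \<and> snd z < \<bar>F (c * fst z)\<bar>} (t, s) \<partial>?\<Lambda>)
          \<le> enn_powr (ennreal KJ * emeasure ?N {t. s < \<bar>F t\<bar>}) (1/p) * indicator {0..} s"
        proof (cases "s \<ge> 0")
          case True
          have "(\<integral>\<^sup>+t. indicator {z. 0 \<le> snd z \<and> snd z < \<bar>F (c * fst z)\<bar>} (t, s) \<partial>?\<Lambda>)
             = (\<integral>\<^sup>+t. indicator {t. c * t \<in> {t. s < \<bar>F t\<bar>}} t \<partial>?\<Lambda>)"
            using True by (intro nn_integral_cong) (auto simp: indicator_def)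
          also have "\<dots> = emeasure ?\<Lambda> {t. c * t \<in> {t. s < \<bar>F t\<bar>}}"
            by (intro nn_integral_indicator) (simp, measurable)
          finally show ?thesis
            using True type[OF c, of "{t. s < \<bar>F t\<bar>}"] by (simp add: b_def)
        qed simp
      qed
      finally have bX: "ennreal b * X \<le> L" .
      \<comment> \<open>The same bound gives the integrability required for the transform to be
        defined.\<close>
      then have X_fin: "X < top" using L_fin b
        by (metis ennreal_mult_eq_top_iff ennreal_eq_0_iff not_le top.not_eq_extremum top_unique)
      have int: "integrable sphere_measure (\<lambda>y. f (T y))"
        using fT_meas norm_int X_fin by (intro integrableI_bounded) (auto simp: ennreal_mult_less_top)
      have "ennreal \<bar>\<integral>y. f (T y) \<partial>sphere_measure\<bar> \<le> ennreal KK * X"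
        using integral_norm_bound_ennreal[OF int] norm_int by simp
      then have "ennreal \<bar>c powr \<gamma> * (\<integral>y. f (T y) \<partial>sphere_measure)\<bar> \<le> ennreal (c powr \<gamma>) * (ennreal KK * X)"
        by (simp add: abs_mult ennreal_mult mult_left_mono)
      \<comment> \<open>As c \<le> 1, a larger \<gamma> only shrinks the left side, so the critical
        exponent is the worst case.\<close>
      also have "\<dots> \<le> ennreal (c powr ((1 + a2) / p)) * (ennreal KK * X)"
        using c \<gamma> by (intro mult_right_mono ennreal_leI powr_mono') auto
      also have "\<dots> = ennreal (KK / c0) * (ennreal b * X)"
      proof -
        have "c powr ((1 + a2) / p) * KK = KK / c0 * b" using c0 by (simp add: b_def)
        then have "ennreal (c powr ((1 + a2) / p)) * ennreal KK = ennreal (KK / c0) * ennreal b"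
          using KK c0 b by (simp add: ennreal_mult[symmetric])
        then show ?thesis by (simp add: mult.assoc[symmetric])
      qed
      also have "\<dots> \<le> ennreal (KK / c0) * L" by (intro mult_left_mono bX) auto
      also have "\<dots> = ennreal C * lorentz_norm ?\<mu> p f"
      proof -
        have "KK / c0 = C * p" using p by (simp add: C_def)
        then show ?thesis using C p by (simp add: lor ennreal_mult mult.assoc)
      qed
      finally show "radon_integrable TYPE('k) f ?V \<and>
          ennreal \<bar>cos (sdist_set e (?V \<inter> sphere 0 1)) powr \<gamma> * radon TYPE('k) f ?V\<bar> \<le> ennreal C * lorentz_norm ?\<mu> p f"
        using int by (simp add: radon_integrable_def radon_def cos T_def)
    qed
  qed
qed

section \<open>Necessary conditions\<close>

lemma continuous_on_matrix_vector_mult_pair: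
  "continuous_on S (\<lambda>z :: (real^'k) \<times> (real^'k^'j). snd z *v fst z)"
  unfolding matrix_vector_mult_def by (intro continuous_intros)

text \<open>The cosine of the distance from e to the column space of A is the maximum of (A y . e) / |A y|.
  The upper bound, being strict, also forces A to be injective.\<close>
lemma open_matrices_projection_between:
  fixes e :: "real^'j"
  shows "open {A :: real^'k^'j. (\<exists>y. c1 * norm (A *v y) < (A *v y) \<bullet> e) \<and>
     (\<forall>y\<in>sphere 0 1. (A *v y) \<bullet> e < c2 * norm (A *v y))}"
proof -
  have 1: "open {A :: real^'k^'j. \<exists>y. c1 * norm (A *v y) < (A *v y) \<bullet> e}"
  proof -
    have cont: "continuous_on UNIV (\<lambda>A :: real^'k^'j. A *v y)" for y
      unfolding matrix_vector_mult_def by (intro continuous_intros)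
    have "open {A :: real^'k^'j. c1 * norm (A *v y) < (A *v y) \<bullet> e}" for y
      by (intro open_Collect_less continuous_intros cont)
    then have "open (\<Union>y. {A :: real^'k^'j. c1 * norm (A *v y) < (A *v y) \<bullet> e})" by blast
    moreover have "(\<Union>y. {A :: real^'k^'j. c1 * norm (A *v y) < (A *v y) \<bullet> e})
       = {A. \<exists>y. c1 * norm (A *v y) < (A *v y) \<bullet> e}" by auto
    ultimately show ?thesis by simp
  qed
  let ?S = "sphere (0 :: real^'k) 1"
  let ?Z = "{z :: (real^'k) \<times> (real^'k^'j). c2 * norm (snd z *v fst z) \<le> (snd z *v fst z) \<bullet> e}"
  \<comment> \<open>The condition for all unit vectors is open because its failure set is the
    projection of a closed set along the compact sphere.\<close>
  have "closed ?Z"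
    by (intro closed_Collect_le continuous_intros continuous_on_matrix_vector_mult_pair)
  then have "closed {A. \<exists>y. y \<in> ?S \<and> (y, A) \<in> ?Z}"
    by (intro closed_compact_projection) auto
  then have "open (- {A. \<exists>y. y \<in> ?S \<and> (y, A) \<in> ?Z})" by (rule open_Compl)
  moreover have "- {A. \<exists>y. y \<in> ?S \<and> (y, A) \<in> ?Z} = {A. \<forall>y\<in>?S. (A *v y) \<bullet> e < c2 * norm (A *v y)}"
    by (force simp: not_le)
  ultimately have 2: "open {A :: real^'k^'j. \<forall>y\<in>?S. (A *v y) \<bullet> e < c2 * norm (A *v y)}" by simp
  show ?thesis using open_Int[OF 1 2] by (simp add: Collect_conj_eq)
qed

text \<open>Embed the parameter space isometrically into the hyperplane orthogonal to e, for which a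
  spare coordinate is available, and tilt one coordinate direction towards e with slope \<tau>. The
  largest cosine on the resulting plane is \<tau> / sqrt (1 + \<tau>^2).\<close>

lemma exists_matrix_projection_between:
  fixes i0 :: "'j::finite"
  defines "e \<equiv> axis i0 1 :: real^'j"
  assumes card: "CARD('k::finite) < CARD('j)" and c: "0 \<le> c1" "c1 < c2" "c2 \<le> 1"
  shows "\<exists>A :: real^'k^'j. (\<exists>y. c1 * norm (A *v y) < (A *v y) \<bullet> e) \<and>
     (\<forall>y\<in>sphere 0 1. (A *v y) \<bullet> e < c2 * norm (A *v y))"
proof -
  have "card (UNIV :: 'k set) \<le> card (UNIV - {i0})" using card by (simp add: card_Diff_singleton)
  then obtain g :: "'k \<Rightarrow> 'j" where g: "inj g" "i0 \<notin> range g"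
    using inj_on_iff_card_le[of "UNIV :: 'k set" "UNIV - {i0}"] by auto
  obtain k0 :: 'k where True by blast
  \<comment> \<open>The midpoint lies strictly between the bounds, hence below 1 even if c2 = 1, so
    the slope is finite.\<close>
  define c where "c = (c1 + c2) / 2"
  have cc: "0 < c" "c < 1" "c1 < c" "c < c2" using c by (auto simp: c_def)
  have c_sq: "c\<^sup>2 < 1" using cc by (simp add: power_less_one_iff)
  \<comment> \<open>The slope for which \<tau> / sqrt (1 + \<tau>^2) = c.\<close>
  define \<tau> where "\<tau> = c / sqrt (1 - c\<^sup>2)"
  have \<tau>: "\<tau> > 0" using cc c_sq by (simp add: \<tau>_def)
  have \<tau>_sq: "\<tau>\<^sup>2 * (1 - c\<^sup>2) = c\<^sup>2" using c_sq by (simp add: \<tau>_def power_divide)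
  define Z where "Z y = (\<Sum>j\<in>UNIV. y $ j *\<^sub>R (axis (g j) 1 :: real^'j))" for y :: "real^'k"
  define h where "h y = (\<tau> * y $ k0) *\<^sub>R e + Z y" for y :: "real^'k"
  have lin: "linear h"
    unfolding h_def Z_def
    by (intro linearI) (simp_all add: scaleR_add_left scaleR_add_right sum.distrib algebra_simps scaleR_sum_right)
  have h: "matrix h *v y = h y" for y by (simp add: matrix_works lin)
  have gi: "g j \<noteq> i0" "i0 \<noteq> g j" for j using g(2) by auto
  have Ze: "Z y \<bullet> e = 0" "e \<bullet> Z y = 0" for y
    by (auto simp: Z_def e_def inner_sum_left inner_sum_right inner_axis_axis gi)
  have ee: "e \<bullet> e = 1" by (simp add: e_def inner_axis_axis)
  have ZZ: "Z y \<bullet> Z y = y \<bullet> y" for y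
  proof -
    have "Z y \<bullet> Z y = (\<Sum>j\<in>UNIV. y $ j * y $ j)"
      by (simp add: Z_def inner_sum_left inner_sum_right inner_axis_axis inj_eq[OF g(1)] if_distrib cong: if_cong)
    then show ?thesis by (simp add: inner_vec_def)
  qed
  have he: "h y \<bullet> e = \<tau> * y $ k0" for y by (simp add: h_def inner_add_left Ze ee)
  have hn: "norm (h y) = sqrt ((\<tau> * y $ k0)\<^sup>2 + (norm y)\<^sup>2)" for y
  proof -
    have "h y \<bullet> h y = (\<tau> * y $ k0)\<^sup>2 + y \<bullet> y"
      by (simp add: h_def inner_add_left inner_add_right Ze ee ZZ power2_eq_square)
    then show ?thesis unfolding norm_eq_sqrt_inner[of "h y"] by (simp add: dot_square_norm)
  qed
  show ?thesis
  proof (intro exI[of _ "matrix h"] conjI ballI exI[of _ "axis k0 1"])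
    have "\<tau>\<^sup>2 = c\<^sup>2 * (\<tau>\<^sup>2 + 1)" using \<tau>_sq by (simp add: algebra_simps)
    then have "\<tau> = c * sqrt (\<tau>\<^sup>2 + 1)" using cc \<tau>
      by (metis abs_of_pos real_sqrt_abs real_sqrt_mult)
    moreover have "c1 * sqrt (\<tau>\<^sup>2 + 1) < c * sqrt (\<tau>\<^sup>2 + 1)"
      using cc by (intro mult_strict_right_mono) (auto simp: add_nonneg_pos)
    ultimately show "c1 * norm (matrix h *v axis k0 1) < (matrix h *v axis k0 1) \<bullet> e"
      by (simp add: h he hn norm_axis_1)
  next
    fix y :: "real^'k" assume "y \<in> sphere 0 1"
    then have y: "norm y = 1" by simp
    define x where "x = \<tau> * y $ k0"
    have "\<bar>y $ k0\<bar> \<le> 1" using component_le_norm_cart[of y k0] y by simp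
    then have "(y $ k0)\<^sup>2 \<le> 1" by (simp add: abs_square_le_1)
    then have "x\<^sup>2 \<le> \<tau>\<^sup>2" by (simp add: x_def power_mult_distrib mult_left_le)
    then have "x\<^sup>2 * (1 - c\<^sup>2) \<le> c\<^sup>2" using c_sq \<tau>_sq by (metis diff_ge_0_iff_ge less_imp_le mult_right_mono)
    then have "x\<^sup>2 \<le> c\<^sup>2 * (x\<^sup>2 + 1)" by (simp add: algebra_simps)
    also have "\<dots> < c2\<^sup>2 * (x\<^sup>2 + 1)"
      using cc by (intro mult_strict_right_mono power_strict_mono) (auto simp: add_nonneg_pos)
    also have "\<dots> = (c2 * sqrt (x\<^sup>2 + 1))\<^sup>2" by (simp add: power_mult_distrib)
    finally have lt: "x\<^sup>2 < (c2 * sqrt (x\<^sup>2 + 1))\<^sup>2" .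
    have "0 \<le> c2 * sqrt (x\<^sup>2 + 1)" using cc by (intro mult_nonneg_nonneg) auto
    with lt have "x < c2 * sqrt (x\<^sup>2 + 1)" by (rule power2_less_imp_less)
    then show "(matrix h *v y) \<bullet> e < c2 * norm (matrix h *v y)"
      by (simp add: h he hn y x_def)
  qed
qed

text \<open>A nonempty open set of matrices is not Lebesgue null, so an almost-everywhere property
  must hold at one of its members. The value of the cosine cannot be prescribed, only an open
  interval for it.\<close>

lemma AE_planes_witness:
  fixes i0 :: "'j::finite"
  defines "e \<equiv> axis i0 1 :: real^'j"
  assumes card: "CARD('k::finite) < CARD('j)" and c: "0 \<le> c1" "c1 < c2" "c2 \<le> 1"
    and AE: "AE_planes TYPE('k) e P"
  obtains V and w :: "real^'k" where "P V" "\<And>y. param_iso V y \<bullet> e = y \<bullet> w"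
    "c1 < norm w" "norm w < c2"
    "sdist_set e (V \<inter> sphere 0 1) = arccos (norm w)"
proof -
  let ?Q = "\<lambda>A :: real^'k^'j. (\<exists>y. c1 * norm (A *v y) < (A *v y) \<bullet> e) \<and>
     (\<forall>y\<in>sphere 0 1. (A *v y) \<bullet> e < c2 * norm (A *v y))"
  let ?R = "\<lambda>A :: real^'k^'j. inj (\<lambda>y. A *v y) \<and> sdist_set e (range (\<lambda>y. A *v y) \<inter> sphere 0 1) < pi / 2
       \<longrightarrow> P (range (\<lambda>y. A *v y))"
  have "\<exists>A. ?Q A \<and> ?R A"
  proof (rule ccontr)
    assume neg: "\<nexists>A. ?Q A \<and> ?R A"
    have ne: "{A. ?Q A} \<noteq> {}"
      unfolding e_def using exists_matrix_projection_between[OF card c, of i0] by blast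
    have op: "open {A. ?Q A}" by (rule open_matrices_projection_between)
    have "AE A in lborel. ?R A" using AE by (simp add: AE_planes_def)
    then have "AE A in lborel. A \<notin> {A. ?Q A}"
      by (rule eventually_mono) (use neg in blast)
    then have "{A. ?Q A} \<in> null_sets lborel"
      using op by (subst AE_iff_null_sets) auto
    then have "negligible {A. ?Q A}"
      unfolding negligible_iff_null_sets by (rule null_sets_completionI)
    then show False using open_not_negligible[OF op ne] by blast
  qed
  then obtain A where Q: "?Q A" and R: "?R A" by blast
  let ?V = "range (\<lambda>y. A *v y)"
  have e: "norm e = 1" by (simp add: e_def norm_axis_1)
  \<comment> \<open>Homogeneity extends the bound from unit vectors to all nonzero y. As it is
    strict, it would read 0 < 0 at a nonzero vector of the kernel.\<close>
  have nz: "(A *v y) \<bullet> e < c2 * norm (A *v y)" if "y \<noteq> 0" for y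
  proof -
    have "(A *v (y /\<^sub>R norm y)) \<bullet> e < c2 * norm (A *v (y /\<^sub>R norm y))" using Q that by simp
    then have "inverse (norm y) * ((A *v y) \<bullet> e) < inverse (norm y) * (c2 * norm (A *v y))"
      using that by (simp add: matrix_vector_mult_scaleR mult_ac)
    then show ?thesis using that by simp
  qed
  have "y = 0" if "A *v y = 0" for y using nz[of y] that by auto
  then have inj: "inj (\<lambda>y. A *v y)"
    by (subst linear_injective_0) auto
  obtain w :: "real^'k" where w: "\<And>y. param_iso ?V y \<bullet> e = y \<bullet> w" "norm w \<le> 1"
    and dist: "sdist_set e (?V \<inter> sphere 0 1) = arccos (norm w)"
    using plane_direction[OF inj e] by metis
  note T = param_iso_range[OF inj]
  have c1: "c1 < norm w"
  proof -
    obtain y where y: "c1 * norm (A *v y) < (A *v y) \<bullet> e" using Q by blast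
    have "A *v y \<in> range (param_iso ?V :: real^'k \<Rightarrow> real^'j)" unfolding T(3) by blast
    then obtain y' :: "real^'k" where y': "A *v y = param_iso ?V y'" by blast
    have "c1 * norm y' < y' \<bullet> w" using y by (simp add: y' w T(2))
    also have "\<dots> \<le> norm w * norm y'" using norm_cauchy_schwarz[of y' w] by (simp add: mult.commute)
    finally show ?thesis by (simp add: mult_less_cancel_right)
  qed
  \<comment> \<open>The upper bound is used at the projection of e to the plane, where the maximal
    cosine is attained.\<close>
  have c2: "norm w < c2"
  proof -
    have w0: "w \<noteq> 0" using c1 c by auto
    have "param_iso ?V w \<in> ?V" using T(3) by blast
    then obtain y where y: "param_iso ?V w = A *v y" by blast
    have "y \<noteq> 0"
    proof
      assume "y = 0"
      then have "norm (param_iso ?V w) = 0" using y by simp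
      then show False using w0 T(2)[of w] by simp
    qed
    then have "w \<bullet> w < c2 * norm w" using nz[of y] by (simp add: y[symmetric] w T(2))
    then show ?thesis using w0 by (simp add: dot_square_norm power2_eq_square)
  qed
  have "0 < norm w" using c1 c by linarith
  then have "arccos (norm w) < pi / 2"
    using arccos_less_arccos[of 0 "norm w"] w(2) by simp
  then have "P ?V" using R inj dist by simp
  then show ?thesis using that w c1 c2 dist by blast
qed

section \<open>Testing the estimate on bands\<close>

lemma enn_powr_le:
  assumes "r \<ge> 0" "M \<ge> 0" "y \<le> ennreal M"
  shows "enn_powr y r \<le> ennreal (M powr r)"
proof -
  obtain z where z: "y = ennreal z" "0 \<le> z" "z \<le> M"
    using assms by (cases y) (auto simp: top_unique)
  then show ?thesis using assms by (simp add: enn_powr_def ennreal_leI powr_mono2)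
qed

text \<open>The test function is the indicator of a band. Its level sets are the band for 0 \<le> s
  < 1 and empty beyond, so its Lorentz norm is governed by the p-th root of the mass. One constant
  serves all bands, which permits the limits taken later.\<close>

lemma radon_estimate_test_interval:
  fixes i0 :: "'j::finite" and \<kappa> a1 a2 p \<gamma> :: real
  defines "e \<equiv> axis i0 1 :: real^'j"
  assumes K: "CARD('k::finite) \<ge> 2" and card: "CARD('k) < CARD('j)"
    and \<kappa>: "real CARD('k) - 1 = 2 * \<kappa>" and a1: "a1 + real CARD('j) - 1 = 2 * (p * \<kappa>)" and p: "p > 0"
    and est: "radon_estimate TYPE('k) e a1 a2 p \<gamma>"
  obtains C where "\<And>a b c1 c2 M. \<lbrakk>0 \<le> c1; c1 < c2; c2 \<le> 1; M \<ge> 0;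
      emeasure (slice_measure a2 (p * \<kappa> - 1)) {a<..<b} \<le> ennreal M\<rbrakk> \<Longrightarrow>
      \<exists>c. c1 < c \<and> c < c2 \<and>
        c powr \<gamma> * measure (slice_measure 0 (\<kappa> - 1)) {t. c * t \<in> {a<..<b}} \<le> C * M powr (1 / p)"
proof -
  have \<kappa>_pos: "\<kappa> > 0" using K \<kappa> by linarith
  have J: "CARD('j) \<ge> 2" using K card by linarith
  have e: "norm e = 1" by (simp add: e_def norm_axis_1)
  let ?\<Lambda> = "slice_measure 0 (\<kappa> - 1)" and ?N = "slice_measure a2 (p * \<kappa> - 1)"
  let ?\<mu> = "weighted_sphere_measure e a1 a2"
  define KJ KK where "KJ = slice_const CARD('j)" and "KK = slice_const CARD('k)"
  have KJ: "KJ > 0" and KK: "KK > 0" using J K by (auto simp: KJ_def KK_def slice_const_pos)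
  have exp1: "(real CARD('k) - 3) / 2 = \<kappa> - 1" using \<kappa> by (simp add: field_simps)
  have exp2: "(a1 + real CARD('j) - 3) / 2 = p * \<kappa> - 1" using a1 by (simp add: field_simps)
  interpret \<Lambda>: finite_measure ?\<Lambda> using \<kappa>_pos by (rule finite_slice_measure)
  obtain C0 where C0: "C0 \<ge> 0" and bound: "\<And>f. f \<in> borel_measurable sphere_measure \<Longrightarrow> even_radial e f \<Longrightarrow>
      lorentz_norm ?\<mu> p f < \<infinity> \<Longrightarrow> AE_planes TYPE('k) e (\<lambda>V. radon_integrable TYPE('k) f V \<and>
       ennreal \<bar>cos (sdist_set e (V \<inter> sphere 0 1)) powr \<gamma> * radon TYPE('k) f V\<bar> \<le> ennreal C0 * lorentz_norm ?\<mu> p f)"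
    using est unfolding radon_estimate_def by blast
  show ?thesis
  proof
    fix a b c1 c2 M :: real
    assume c: "0 \<le> c1" "c1 < c2" "c2 \<le> 1" and M: "M \<ge> 0"
      and NM: "emeasure ?N {a<..<b} \<le> ennreal M"
    define F :: "real \<Rightarrow> real" where "F = indicator {a<..<b}"
    have [measurable]: "F \<in> borel_measurable borel" unfolding F_def by measurable
    define f where "f x = F \<bar>x \<bullet> e\<bar>" for x :: "real^'j"
    have f: "f \<in> borel_measurable sphere_measure"
      unfolding f_def by (rule borel_measurable_sphere_measure_inner) measurable
    have rad: "even_radial e f" unfolding even_radial_def f_def by blast
    have lor: "lorentz_norm ?\<mu> p f \<le> ennreal (p * (KJ * M) powr (1 / p))"
    proof -
      have "(\<integral>\<^sup>+ s\<in>{0..}. enn_powr (emeasure ?\<mu> {x\<in>space ?\<mu>. \<bar>f x\<bar> > s}) (1/p) \<partial>lborel)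
         \<le> (\<integral>\<^sup>+ s. ennreal ((KJ * M) powr (1 / p)) * indicator {0..1::real} s \<partial>lborel)"
      proof (rule nn_integral_mono)
        fix s :: real
        show "enn_powr (emeasure ?\<mu> {x\<in>space ?\<mu>. \<bar>f x\<bar> > s}) (1/p) * indicator {0..} s
           \<le> ennreal ((KJ * M) powr (1 / p)) * indicator {0..1} s"
        proof (cases "0 \<le> s \<and> s < 1")
          case True
          then have "{x\<in>space ?\<mu>. \<bar>f x\<bar> > s} = {x \<in> sphere 0 1. \<bar>x \<bullet> e\<bar> \<in> {a<..<b}}"
            by (auto simp: f_def F_def indicator_def split: if_splits)
          then have "emeasure ?\<mu> {x\<in>space ?\<mu>. \<bar>f x\<bar> > s} = ennreal KJ * emeasure ?N {a<..<b}"
            using emeasure_weighted_sphere_slice[OF e J, of "{a<..<b}" a1 a2] by (simp only: exp2 KJ_def) simp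
          also have "\<dots> \<le> ennreal (KJ * M)" using NM KJ M by (simp add: ennreal_mult mult_left_mono)
          finally show ?thesis using True KJ M p by (simp add: enn_powr_le)
        next
          case False
          then have "{x\<in>space ?\<mu>. \<bar>f x\<bar> > s} = {} \<or> s < 0"
            by (auto simp: f_def F_def indicator_def split: if_splits)
          then show ?thesis
          proof
            assume empty: "{x\<in>space ?\<mu>. \<bar>f x\<bar> > s} = {}"
            show ?thesis unfolding empty by (simp add: enn_powr_def)
          qed simp
        qed
      qed
      also have "\<dots> = ennreal ((KJ * M) powr (1 / p))" by (simp add: nn_integral_cmult)
      finally show ?thesis unfolding lorentz_norm_def using p by (simp add: ennreal_mult mult_left_mono)
    qed
    then have fin: "lorentz_norm ?\<mu> p f < \<infinity>" by (metis ennreal_less_top infinity_ennreal_def le_less_trans)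
    obtain V and w :: "real^'k" where V: "radon_integrable TYPE('k) f V"
        "ennreal \<bar>cos (sdist_set e (V \<inter> sphere 0 1)) powr \<gamma> * radon TYPE('k) f V\<bar> \<le> ennreal C0 * lorentz_norm ?\<mu> p f"
      and w: "\<And>y. param_iso V y \<bullet> e = y \<bullet> w" "c1 < norm w" "norm w < c2"
      and dist: "sdist_set e (V \<inter> sphere 0 1) = arccos (norm w)"
      using AE_planes_witness[OF card c bound[OF f rad fin, unfolded e_def]] unfolding e_def by metis
    have w0: "w \<noteq> 0" using w c by auto
    have cos: "cos (sdist_set e (V \<inter> sphere 0 1)) = norm w"
      unfolding dist using w c by (intro cos_arccos) auto
    define E where "E = {t. norm w * t \<in> {a<..<b}}"
    have [measurable]: "E \<in> sets borel" unfolding E_def by measurable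
    have radon: "radon TYPE('k) f V = KK * measure ?\<Lambda> E"
    proof -
      let ?g = "\<lambda>y :: real^'k. f (param_iso V y)"
      have "ennreal (integral\<^sup>L sphere_measure ?g) = (\<integral>\<^sup>+y. ennreal (?g y) \<partial>sphere_measure)"
        using V(1) by (intro nn_integral_eq_integral[symmetric]) (auto simp: radon_integrable_def f_def F_def)
      also have "\<dots> = (\<integral>\<^sup>+y. (\<lambda>t. ennreal (F t)) \<bar>y \<bullet> w\<bar> \<partial>sphere_measure)"
        by (simp add: f_def w)
      also have "\<dots> = ennreal KK * (\<integral>\<^sup>+t. ennreal (F (norm w * t)) \<partial>?\<Lambda>)"
        by (subst nn_integral_sphere_dilated_slice[OF w0 K]) (simp_all add: exp1 KK_def)
      also have "(\<integral>\<^sup>+t. ennreal (F (norm w * t)) \<partial>?\<Lambda>) = (\<integral>\<^sup>+t. indicator E t \<partial>?\<Lambda>)"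
        by (intro nn_integral_cong) (auto simp: F_def E_def indicator_def)
      also have "ennreal KK * \<dots> = ennreal (KK * measure ?\<Lambda> E)"
        using KK by (simp add: \<Lambda>.emeasure_eq_measure ennreal_mult)
      finally have "ennreal (integral\<^sup>L sphere_measure ?g) = ennreal (KK * measure ?\<Lambda> E)" .
      moreover have "integral\<^sup>L sphere_measure ?g \<ge> 0"
        by (intro integral_nonneg_AE) (auto simp: f_def F_def)
      ultimately show ?thesis using KK by (simp add: radon_def)
    qed
    have "ennreal (norm w powr \<gamma> * (KK * measure ?\<Lambda> E)) \<le> ennreal C0 * ennreal (p * (KJ * M) powr (1 / p))"
    proof -
      have "ennreal (norm w powr \<gamma> * (KK * measure ?\<Lambda> E)) \<le> ennreal C0 * lorentz_norm ?\<mu> p f"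
        using V(2) KK by (simp add: cos radon abs_mult)
      also have "\<dots> \<le> ennreal C0 * ennreal (p * (KJ * M) powr (1 / p))"
        by (intro mult_left_mono lor) auto
      finally show ?thesis .
    qed
    then have "norm w powr \<gamma> * (KK * measure ?\<Lambda> E) \<le> C0 * (p * (KJ * M) powr (1 / p))"
      using C0 p by (simp add: ennreal_mult[symmetric])
    then have "norm w powr \<gamma> * measure ?\<Lambda> E \<le> C0 * (p * (KJ powr (1 / p) * M powr (1 / p))) / KK"
      using KK KJ M by (simp add: powr_mult field_simps)
    then show "\<exists>c. c1 < c \<and> c < c2 \<and> c powr \<gamma> * measure ?\<Lambda> {t. c * t \<in> {a<..<b}}
        \<le> (C0 * p * KJ powr (1 / p) / KK) * M powr (1 / p)"
      using w by (intro exI[of _ "norm w"]) (simp add: E_def mult_ac)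
  qed
qed

lemma emeasure_slice_interval_le:
  assumes "l \<le> u" "0 \<le> h"
    and "\<And>t. \<lbrakk>l < t; t < u; 0 < t; t < 1\<rbrakk> \<Longrightarrow> t powr a * (1 - t\<^sup>2) powr b \<le> h"
  shows "emeasure (slice_measure a b) {l<..<u} \<le> ennreal (h * (u - l))"
proof -
  have "emeasure (slice_measure a b) {l<..<u} \<le> (\<integral>\<^sup>+t. ennreal h * indicator {l<..<u} t \<partial>lborel)"
    using assms by (subst emeasure_slice_measure) (auto intro!: nn_integral_mono ennreal_leI simp: indicator_def)
  also have "\<dots> = ennreal (h * (u - l))"
    using assms by (simp add: nn_integral_cmult ennreal_mult)
  finally show ?thesis .
qed

lemma measure_slice_interval_ge:
  assumes \<kappa>: "\<kappa> > 0" and lu: "0 \<le> l" "l \<le> u" "u \<le> 1" and h: "0 \<le> h"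
    and dens: "\<And>t. \<lbrakk>l < t; t < u\<rbrakk> \<Longrightarrow> h \<le> (1 - t\<^sup>2) powr (\<kappa> - 1)"
    and E: "{l<..<u} \<subseteq> E" "E \<in> sets borel"
  shows "h * (u - l) \<le> measure (slice_measure 0 (\<kappa> - 1)) E"
proof -
  interpret finite_measure "slice_measure 0 (\<kappa> - 1)" using \<kappa> by (rule finite_slice_measure)
  have "ennreal (h * (u - l)) = (\<integral>\<^sup>+t. ennreal h * indicator {l<..<u} t \<partial>lborel)"
    using lu h by (simp add: nn_integral_cmult ennreal_mult)
  also have "\<dots> \<le> emeasure (slice_measure 0 (\<kappa> - 1)) E"
    using lu E dens by (subst emeasure_slice_measure) (auto intro!: nn_integral_mono ennreal_leI simp: indicator_def)
  finally show ?thesis by (simp add: emeasure_eq_measure)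
qed

text \<open>Bounds that do not depend on the sign of the exponent, since a2 and \<gamma> may have
  either sign.\<close>

lemma powr_abs_bounds:
  fixes x r s :: real
  assumes "0 < r" "r \<le> x" "x \<le> 1"
  shows "r powr \<bar>s\<bar> \<le> x powr s" "x powr s \<le> (1 / r) powr \<bar>s\<bar>"
proof -
  have "r powr \<bar>s\<bar> \<le> x powr \<bar>s\<bar>" using assms by (intro powr_mono2) auto
  also have "\<dots> \<le> x powr s" using assms by (intro powr_mono') auto
  finally show "r powr \<bar>s\<bar> \<le> x powr s" .
  have "x powr s \<le> x powr - \<bar>s\<bar>" using assms by (intro powr_mono') auto
  also have "\<dots> \<le> r powr - \<bar>s\<bar>" using assms by (intro powr_mono2') auto
  also have "\<dots> = (1 / r) powr \<bar>s\<bar>" using assms by (simp add: powr_minus powr_divide inverse_eq_divide)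
  finally show "x powr s \<le> (1 / r) powr \<bar>s\<bar>" .
qed

text \<open>If s < t, division by \<delta> powr s would leave A \<le> D * \<delta> powr (t - s),
  whose right side tends to 0 with \<delta>.\<close>

lemma powr_le_powr_near_0_imp:
  fixes s t A D d :: real
  assumes "A > 0" "d > 0" and "\<And>\<delta>. \<lbrakk>0 < \<delta>; \<delta> < d\<rbrakk> \<Longrightarrow> A * \<delta> powr s \<le> D * \<delta> powr t"
  shows "t \<le> s"
proof (rule ccontr)
  assume "\<not> t \<le> s"
  then have \<eta>: "t - s > 0" by simp
  \<comment> \<open>The summand 1 makes A * B strictly larger than |D| and keeps B positive when D =
    0; \<delta> is then chosen with \<delta> powr (t - s) \<le> 1 / B.\<close>
  define B where "B = \<bar>D\<bar> / A + 1"
  have B: "B > 0" using assms by (simp add: B_def add_nonneg_pos)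
  define \<delta> where "\<delta> = min (d / 2) (B powr (- 1 / (t - s)))"
  have \<delta>: "0 < \<delta>" "\<delta> < d" "\<delta> \<le> B powr (- 1 / (t - s))" using assms B by (auto simp: \<delta>_def)
  have "\<delta> powr (t - s) \<le> (B powr (- 1 / (t - s))) powr (t - s)"
    using \<delta> \<eta> by (intro powr_mono2) auto
  also have "\<dots> = 1 / B" using B \<eta> by (simp only: powr_powr) (simp add: powr_minus inverse_eq_divide)
  finally have small: "B * \<delta> powr (t - s) \<le> 1" using B by (simp add: field_simps)
  have "A * \<delta> powr s \<le> D * (\<delta> powr s * \<delta> powr (t - s))"
    using assms(3)[OF \<delta>(1,2)] unfolding powr_add[symmetric] by simp
  then have "A \<le> D * \<delta> powr (t - s)" using \<delta>(1)
    by (simp add: mult.left_commute[of D] mult.commute[of A])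
  also have "\<dots> \<le> \<bar>D\<bar> * \<delta> powr (t - s)" by (intro mult_right_mono) auto
  also have "\<dots> < (A * B) * \<delta> powr (t - s)"
    using assms \<delta> by (intro mult_strict_right_mono) (auto simp: B_def field_simps)
  also have "\<dots> \<le> A * 1"
    unfolding mult.assoc using small assms by (intro mult_left_mono) auto
  finally show False by simp
qed

context
  fixes i0 :: "'j::finite" and \<kappa> a1 a2 p \<gamma> :: real
  assumes K: "CARD('k::finite) \<ge> 2" and card: "CARD('k) < CARD('j)"
    and \<kappa>: "real CARD('k) - 1 = 2 * \<kappa>" and a1: "a1 + real CARD('j) - 1 = 2 * (p * \<kappa>)" and p: "p > 0"
    and est: "radon_estimate TYPE('k) (axis i0 1 :: real^'j) a1 a2 p \<gamma>"
begin

text \<open>Tested on the bands \<delta>/2 < |x . e| < \<delta> and planes with cosine in (3\<delta>/4, \<delta>), as \<delta> tends to 0.\<close>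
lemma radon_estimate_imp_gamma_ge: "\<gamma> \<ge> (1 + a2) / p"
proof -
  have \<kappa>_pos: "\<kappa> > 0" using K \<kappa> by linarith
  let ?\<Lambda> = "slice_measure 0 (\<kappa> - 1)" and ?N = "slice_measure a2 (p * \<kappa> - 1)"
  obtain C where C: "\<And>a b c1 c2 M. \<lbrakk>0 \<le> c1; c1 < c2; c2 \<le> 1; M \<ge> 0;
      emeasure ?N {a<..<b} \<le> ennreal M\<rbrakk> \<Longrightarrow>
      \<exists>c. c1 < c \<and> c < c2 \<and> c powr \<gamma> * measure ?\<Lambda> {t. c * t \<in> {a<..<b}} \<le> C * M powr (1 / p)"
    using radon_estimate_test_interval[OF K card \<kappa> a1 p est] by metis
  \<comment> \<open>A lower bound for the mass of (2/3, 3/4). For 3\<delta>/4 < c < \<delta> these t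
    satisfy \<delta>/2 < c t < \<delta>, since 3/4 * 2/3 = 1/2; and t < 3/4 gives 1 - t^2 \<ge>
    7/16.\<close>
  define m0 where "m0 = (7/16) powr \<kappa> * (3/4 - 2/3)"
  \<comment> \<open>The first factor bounds (t / \<delta>) powr a2 for 1/2 < t / \<delta> < 1. The
    second bounds the power of 1 - t^2, which exceeds 3/4 because \<delta> < 1/2.\<close>
  define H where "H = 2 powr \<bar>a2\<bar> * (4/3)"
  have H: "H > 0" by (simp add: H_def)
  show ?thesis
  proof (rule powr_le_powr_near_0_imp)
    show "(3/4) powr \<bar>\<gamma>\<bar> * m0 > 0" by (simp add: m0_def)
    show "1/2 > (0::real)" by simp
    fix \<delta> :: real assume \<delta>: "0 < \<delta>" "\<delta> < 1/2"
    define M where "M = H / 2 * \<delta> powr (1 + a2)"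
    have "emeasure ?N {\<delta>/2<..<\<delta>} \<le> ennreal (H * \<delta> powr a2 * (\<delta> - \<delta> / 2))"
    proof (rule emeasure_slice_interval_le)
      fix t assume t: "\<delta>/2 < t" "t < \<delta>" "0 < t" "t < 1"
      have "t powr a2 = \<delta> powr a2 * (t / \<delta>) powr a2" using t \<delta> by (simp add: powr_divide)
      also have "\<dots> \<le> \<delta> powr a2 * 2 powr \<bar>a2\<bar>"
        using powr_abs_bounds(2)[of "1/2" "t / \<delta>" a2] t \<delta> by (intro mult_left_mono) (auto simp: field_simps)
      finally have 1: "t powr a2 \<le> \<delta> powr a2 * 2 powr \<bar>a2\<bar>" .
      have "t\<^sup>2 \<le> (1/2)\<^sup>2" using t \<delta> by (intro power_mono) auto
      then have "(1 - t\<^sup>2) powr (p * \<kappa> - 1) \<le> 4/3"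
        using p \<kappa>_pos by (intro powr_le_four_thirds) (auto simp: power2_eq_square)
      with 1 have "t powr a2 * (1 - t\<^sup>2) powr (p * \<kappa> - 1) \<le> (\<delta> powr a2 * 2 powr \<bar>a2\<bar>) * (4/3)"
        by (intro mult_mono) auto
      then show "t powr a2 * (1 - t\<^sup>2) powr (p * \<kappa> - 1) \<le> H * \<delta> powr a2" by (simp add: H_def mult_ac)
    qed (use \<delta> H in auto)
    also have "H * \<delta> powr a2 * (\<delta> - \<delta> / 2) = M" using \<delta> by (simp add: M_def powr_add)
    finally have NM: "emeasure ?N {\<delta>/2<..<\<delta>} \<le> ennreal M" .
    obtain c where c: "3/4 * \<delta> < c" "c < \<delta>"
      and le: "c powr \<gamma> * measure ?\<Lambda> {t. c * t \<in> {\<delta>/2<..<\<delta>}} \<le> C * M powr (1 / p)"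
      using C[OF _ _ _ _ NM, of "3/4 * \<delta>" \<delta>] \<delta> H by (auto simp: M_def)
    have lower: "m0 \<le> measure ?\<Lambda> {t. c * t \<in> {\<delta>/2<..<\<delta>}}"
      unfolding m0_def
    proof (rule measure_slice_interval_ge[OF \<kappa>_pos])
      fix t :: real assume t: "2/3 < t" "t < 3/4"
      have "t\<^sup>2 \<le> (3/4)\<^sup>2" using t by (intro power_mono) auto
      then have q: "7/16 \<le> 1 - t\<^sup>2" by (simp add: power2_eq_square)
      have "(7/16) powr \<kappa> \<le> (1 - t\<^sup>2) powr \<kappa>" using q \<kappa>_pos by (intro powr_mono2) auto
      \<comment> \<open>Raising the exponent from \<kappa> - 1 to \<kappa> gives a lower bound
        whatever the sign of \<kappa> - 1.\<close>
      also have "\<dots> \<le> (1 - t\<^sup>2) powr (\<kappa> - 1)" using q by (intro powr_mono') auto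
      finally show "(7/16) powr \<kappa> \<le> (1 - t\<^sup>2) powr (\<kappa> - 1)" .
    next
      show "{2/3<..<3/4} \<subseteq> {t. c * t \<in> {\<delta>/2<..<\<delta>}}"
      proof
        fix t :: real assume t: "t \<in> {2/3<..<3/4}"
        have "3/4 * \<delta> * (2/3) < c * t" using c t \<delta> by (intro mult_strict_mono) auto
        moreover have "c * t < \<delta> * 1" using c t \<delta> by (intro mult_strict_mono) auto
        ultimately show "t \<in> {t. c * t \<in> {\<delta>/2<..<\<delta>}}" by simp
      qed
      show "{t. c * t \<in> {\<delta>/2<..<\<delta>}} \<in> sets borel" by measurable
    qed auto
    have "(3/4) powr \<bar>\<gamma>\<bar> * \<delta> powr \<gamma> \<le> (c / \<delta>) powr \<gamma> * \<delta> powr \<gamma>"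
      using powr_abs_bounds(1)[of "3/4" "c / \<delta>" \<gamma>] c \<delta> by (intro mult_right_mono) (auto simp: field_simps)
    also have "\<dots> = c powr \<gamma>" using c \<delta> by (simp add: powr_divide)
    finally have "(3/4) powr \<bar>\<gamma>\<bar> * \<delta> powr \<gamma> * m0 \<le> c powr \<gamma> * measure ?\<Lambda> {t. c * t \<in> {\<delta>/2<..<\<delta>}}"
      using lower by (intro mult_mono) (auto simp: m0_def)
    also have "\<dots> \<le> C * M powr (1 / p)" by fact
    also have "M powr (1 / p) = (H / 2) powr (1 / p) * \<delta> powr ((1 + a2) / p)"
      unfolding M_def using H \<delta> by (subst powr_mult) (simp_all add: powr_powr)
    finally show "(3/4) powr \<bar>\<gamma>\<bar> * m0 * \<delta> powr \<gamma> \<le> C * (H / 2) powr (1 / p) * \<delta> powr ((1 + a2) / p)"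
      by (simp add: mult_ac)
  qed
qed

text \<open>Tested on the bands 1/2 - \<epsilon> < |x . e| < 1/2 and planes almost tangent to them from inside,
  where the weight (1 - t^2) powr (- 1/2) blows up.\<close>
lemma radon_estimate_imp_p_ge:
  assumes \<kappa>_half: "\<kappa> = 1/2"
  shows "p \<ge> 2"
proof -
  let ?\<Lambda> = "slice_measure 0 (\<kappa> - 1)" and ?N = "slice_measure a2 (p * \<kappa> - 1)"
  obtain C where C: "\<And>a b c1 c2 M. \<lbrakk>0 \<le> c1; c1 < c2; c2 \<le> 1; M \<ge> 0;
      emeasure ?N {a<..<b} \<le> ennreal M\<rbrakk> \<Longrightarrow>
      \<exists>c. c1 < c \<and> c < c2 \<and> c powr \<gamma> * measure ?\<Lambda> {t. c * t \<in> {a<..<b}} \<le> C * M powr (1 / p)"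
    using radon_estimate_test_interval[OF K card \<kappa> a1 p est] by metis
  \<comment> \<open>With \<epsilon> < 1/4 the band lies in (1/4, 1/2), so both factors of the
    density are bounded there.\<close>
  define H where "H = 4 powr \<bar>a2\<bar> * (4/3)"
  have H: "H > 0" by (simp add: H_def)
  have "1 / p \<le> 1 / 2"
  proof (rule powr_le_powr_near_0_imp)
    show "(1/4) powr \<bar>\<gamma>\<bar> * 2 powr (-1/2) > (0::real)" by simp
    show "1/4 > (0::real)" by simp
    fix \<epsilon> :: real assume \<epsilon>: "0 < \<epsilon>" "\<epsilon> < 1/4"
    have "emeasure ?N {1/2 - \<epsilon><..<1/2} \<le> ennreal (H * (1/2 - (1/2 - \<epsilon>)))"
    proof (rule emeasure_slice_interval_le)
      fix t :: real assume t: "1/2 - \<epsilon> < t" "t < 1/2" "0 < t" "t < 1"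
      have 1: "t powr a2 \<le> 4 powr \<bar>a2\<bar>"
        using powr_abs_bounds(2)[of "1/4" t a2] t \<epsilon> by auto
      have "t\<^sup>2 \<le> (1/2)\<^sup>2" using t by (intro power_mono) auto
      then have "(1 - t\<^sup>2) powr (p * \<kappa> - 1) \<le> 4/3"
        using p \<kappa>_half by (intro powr_le_four_thirds) (auto simp: power2_eq_square)
      with 1 show "t powr a2 * (1 - t\<^sup>2) powr (p * \<kappa> - 1) \<le> H"
        unfolding H_def by (intro mult_mono) auto
    qed (use \<epsilon> H in auto)
    then have NM: "emeasure ?N {1/2 - \<epsilon><..<1/2} \<le> ennreal (H * \<epsilon>)" by simp
    obtain c where c: "1/2 - \<epsilon>/2 < c" "c < 1/2"
      and le: "c powr \<gamma> * measure ?\<Lambda> {t. c * t \<in> {1/2 - \<epsilon><..<1/2}} \<le> C * (H * \<epsilon>) powr (1 / p)"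
      using C[OF _ _ _ _ NM, of "1/2 - \<epsilon>/2" "1/2"] \<epsilon> H by auto
    \<comment> \<open>For every c in (1/2 - \<epsilon>/2, 1/2) the band contains c t for all t in (1
      - \<epsilon>, 1). There the density is at least (2 \<epsilon>) powr (- 1/2), so a segment of
      length \<epsilon> has mass at least of order \<epsilon> powr (1/2), against the norm of order
      \<epsilon> powr (1/p).\<close>
    have lower: "(2 * \<epsilon>) powr (-1/2) * (1 - (1 - \<epsilon>)) \<le> measure ?\<Lambda> {t. c * t \<in> {1/2 - \<epsilon><..<1/2}}"
    proof (rule measure_slice_interval_ge)
      fix t :: real assume t: "1 - \<epsilon> < t" "t < 1"
      have "1 - t\<^sup>2 = (1 - t) * (1 + t)" by (simp add: power2_eq_square algebra_simps)
      also have "\<dots> \<le> \<epsilon> * 2" using t \<epsilon> by (intro mult_mono) auto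
      finally have "1 - t\<^sup>2 \<le> 2 * \<epsilon>" by simp
      moreover have "0 < 1 - t\<^sup>2" using one_minus_square_bounds[of t] t \<epsilon> by auto
      ultimately show "(2 * \<epsilon>) powr (-1/2) \<le> (1 - t\<^sup>2) powr (\<kappa> - 1)"
        unfolding \<kappa>_half using powr_mono2'[of "-1/2" "1 - t\<^sup>2" "2 * \<epsilon>"] by simp
    next
      show "{1 - \<epsilon><..<1} \<subseteq> {t. c * t \<in> {1/2 - \<epsilon><..<1/2}}"
      proof
        fix t :: real assume t: "t \<in> {1 - \<epsilon><..<1}"
        have "1/2 - \<epsilon> < (1/2 - \<epsilon>/2) * (1 - \<epsilon>)" using \<epsilon> by (simp add: algebra_simps)
        also have "\<dots> < c * t" using c t \<epsilon> by (intro mult_strict_mono) auto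
        finally have "1/2 - \<epsilon> < c * t" .
        moreover have "c * t < 1/2 * 1" using c t \<epsilon> by (intro mult_strict_mono) auto
        ultimately show "t \<in> {t. c * t \<in> {1/2 - \<epsilon><..<1/2}}" by simp
      qed
      show "{t. c * t \<in> {1/2 - \<epsilon><..<1/2}} \<in> sets borel" by measurable
    qed (use \<epsilon> \<kappa>_half in auto)
    have "(2 * \<epsilon>) powr (-1/2) * (1 - (1 - \<epsilon>)) = 2 powr (-1/2) * (\<epsilon> powr (-1/2) * \<epsilon> powr 1)"
      using \<epsilon> by (simp add: powr_mult)
    also have "\<dots> = 2 powr (-1/2) * \<epsilon> powr (1/2)" unfolding powr_add[symmetric] by simp
    finally have lower': "2 powr (-1/2) * \<epsilon> powr (1/2) \<le> measure ?\<Lambda> {t. c * t \<in> {1/2 - \<epsilon><..<1/2}}"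
      using lower by simp
    have "(1/4) powr \<bar>\<gamma>\<bar> \<le> c powr \<gamma>" using powr_abs_bounds(1)[of "1/4" c \<gamma>] c \<epsilon> by auto
    with lower' have "(1/4) powr \<bar>\<gamma>\<bar> * (2 powr (-1/2) * \<epsilon> powr (1/2)) \<le> c powr \<gamma> * measure ?\<Lambda> {t. c * t \<in> {1/2 - \<epsilon><..<1/2}}"
      by (intro mult_mono) auto
    also have "\<dots> \<le> C * (H * \<epsilon>) powr (1 / p)" by fact
    also have "(H * \<epsilon>) powr (1 / p) = H powr (1 / p) * \<epsilon> powr (1 / p)" using H \<epsilon> by (simp add: powr_mult)
    finally show "(1/4) powr \<bar>\<gamma>\<bar> * 2 powr (-1/2) * \<epsilon> powr (1/2) \<le> C * H powr (1 / p) * \<epsilon> powr (1 / p)"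
      by (simp add: mult_ac)
  qed
  then show ?thesis using p by (simp add: field_simps)
qed

end

theorem theorem5p9:
  fixes n k :: nat and a1 a2 p \<gamma> :: real and i0 :: "'j::finite"
  assumes "CARD('j) = n + 1" and "CARD('k::finite) = k + 1"
    and "n \<ge> 2" and "1 \<le> k" and "k \<le> n - 1"
    and "a1 \<ge> real k - real n"
    and "p = (a1 + real n) / real k"
    and "p \<ge> 1 + a2" and "a2 > 0 \<longrightarrow> p > 1 + a2"
  shows "(k \<ge> 2 \<longrightarrow>
            (radon_estimate TYPE('k) (axis i0 1 :: real^'j) a1 a2 p \<gamma>
               \<longleftrightarrow> \<gamma> \<ge> (1 + a2) / p))
       \<and> (k = 1 \<longrightarrow>
            (radon_estimate TYPE('k) (axis i0 1 :: real^'j) a1 a2 p \<gamma>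
               \<longleftrightarrow> \<gamma> \<ge> (1 + a2) / p \<and> p \<ge> 2))"
proof -
  let ?e = "axis i0 1 :: real^'j" and ?\<kappa> = "real k / 2"
  have J: "CARD('j) \<ge> 2" and K: "CARD('k) \<ge> 2" and card: "CARD('k) < CARD('j)" using assms(1-5) by auto
  have \<kappa>: "real CARD('k) - 1 = 2 * ?\<kappa>" using assms(2) by simp
  have a1: "a1 + real CARD('j) - 1 = 2 * (p * ?\<kappa>)" using assms(1,4,7) by simp
  \<comment> \<open>As p k = a1 + n, the lower bound on a1 is the same as p \<ge> 1.\<close>
  have p1: "p \<ge> 1" using assms(4,6) unfolding assms(7) by (simp add: le_divide_eq)
  have e: "norm ?e = 1" by (simp add: norm_axis_1)
  have suff: "radon_estimate TYPE('k) ?e a1 a2 p \<gamma>" if "p * ?\<kappa> \<ge> 1" "\<gamma> \<ge> (1 + a2) / p"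
    by (rule radon_estimate_sufficient[OF e J K \<kappa> a1 p1 assms(8) that])
  have nec1: "\<gamma> \<ge> (1 + a2) / p" if "radon_estimate TYPE('k) ?e a1 a2 p \<gamma>"
    using p1 that by (intro radon_estimate_imp_gamma_ge[OF K card \<kappa> a1]) auto
  have nec2: "p \<ge> 2" if "radon_estimate TYPE('k) ?e a1 a2 p \<gamma>" "k = 1"
    using p1 that by (intro radon_estimate_imp_p_ge[OF K card \<kappa> a1]) auto
  \<comment> \<open>The two cases of the theorem part here: p k/2 \<ge> 1 follows from p \<ge> 1 if
    k \<ge> 2, and is the condition p \<ge> 2 if k = 1.\<close>
  have "p * ?\<kappa> \<ge> 1" if "k \<ge> 2"
    using mult_mono[of 1 p 1 ?\<kappa>] p1 that by simp
  moreover have "p * ?\<kappa> \<ge> 1" if "k = 1" "p \<ge> 2" using that by simp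
  ultimately show ?thesis using suff nec1 nec2 by blast
qed

end
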